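(* Let $\Omega\subset\mathbb{R}^n$, $n\ge 2$, be a bounded domain, $b\in C(\partial\Omega)$, $f\in C(\Omega\times\mathbb{R},\mathbb{R})$, and let $g\in C(\mathbb{R},\mathbb{R})$ be such that there exists $s_0\ge 0$ with $g\ge 0$ on $[s_0,\infty)$ and $g\le 0$ on $(-\infty,-s_0]$. Put $G(s)=\int_0^s g(\tau)\,d\tau$. Suppose that: (i) for every compact interval $I\subset\mathbb{R}$, $\displaystyle\sup_{\Omega\times I}|f(x,t)|<\infty$; (ii) for some $\nu,\xi\in[-\infty,0]$, $$\limsup_{t\to\infty}\frac{\sup_{x\in\Omega}\mathrm{e}^{3G(t)}f(x,t)}{\left(\int_0^t \mathrm{e}^{G(s)}\,ds\right)^3}=\nu\quad\text{and}\quad \limsup_{t\to-\infty}\frac{\inf_{x\in\Omega}\mathrm{e}^{3G(t)}f(x,t)}{\left(\int_0^t \mathrm{e}^{G(s)}\,ds\right)^3}=\xi .$$ Then the Dirichlet problem $$\Delta_\infty u+g(u)|Du|^4+f(x,u)=0\ \text{ in }\Omega,\qquad u=b\ \text{ on }\partial\Omega$$ admits a viscosity solution $u\in C(\overline{\Omega})$.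
   Context: The infinity-Laplacian is $\Delta_\infty u=\langle D^2u\,Du,Du\rangle$. A function $u\in C(\overline\Omega)$ is a viscosity solution of the Dirichlet problem if $u=b$ on $\partial\Omega$ pointwise and the following two conditions hold. Subsolution: whenever $\varphi\in C^2(\Omega)$ and $u-\varphi$ has a local maximum at $x_0\in\Omega$, then $\langle D^2\varphi(x_0)D\varphi(x_0),D\varphi(x_0)\rangle+g(u(x_0))|D\varphi(x_0)|^4+f(x_0,u(x_0))\ge 0$. Supersolution: whenever $\varphi\in C^2(\Omega)$ and $u-\varphi$ has a local minimum at $x_0\in\Omega$, then $\langle D^2\varphi(x_0)D\varphi(x_0),D\varphi(x_0)\rangle+g(u(x_0))|D\varphi(x_0)|^4+f(x_0,u(x_0))\le 0$. *)

theory Defs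
  imports "HOL-Analysis.Analysis"
begin

text \<open>The derivatives are taken in the full neighbourhood filter, so \<open>S\<close> is meant to be open.
  Continuity of \<open>\<phi>\<close> and \<open>D\<phi>\<close> on \<open>S\<close> follows from differentiability.\<close>

definition has_C2_derivs ::
  "(real^'n \<Rightarrow> real) \<Rightarrow> (real^'n \<Rightarrow> real^'n) \<Rightarrow> (real^'n \<Rightarrow> real^'n^'n) \<Rightarrow> (real^'n) set \<Rightarrow> bool"
where
  "has_C2_derivs \<phi> D\<phi> D2\<phi> S \<longleftrightarrow>
     (\<forall>x\<in>S. GDERIV \<phi> x :> D\<phi> x) \<and>
     (\<forall>x\<in>S. (D\<phi> has_derivative (\<lambda>h. D2\<phi> x *v h)) (at x)) \<and>
     continuous_on S D2\<phi>"

text \<open>The operator in terms of a gradient \<open>p\<close>, a Hessian \<open>X\<close>, a point \<open>x\<close> and a value \<open>r\<close>.\<close>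

definition inf_lap_op ::
  "(real^'n \<Rightarrow> real \<Rightarrow> real) \<Rightarrow> (real \<Rightarrow> real) \<Rightarrow> real^'n \<Rightarrow> real \<Rightarrow> real^'n \<Rightarrow> real^'n^'n \<Rightarrow> real"
where
  "inf_lap_op f g x r p X = (X *v p) \<bullet> p + g r * norm p ^ 4 + f x r"

definition viscosity_subsolution ::
  "(real^'n) set \<Rightarrow> (real^'n \<Rightarrow> real \<Rightarrow> real) \<Rightarrow> (real \<Rightarrow> real) \<Rightarrow> (real^'n \<Rightarrow> real) \<Rightarrow> bool"
where
  "viscosity_subsolution \<Omega> f g u \<longleftrightarrow>
     (\<forall>\<phi> D\<phi> D2\<phi> x0. has_C2_derivs \<phi> D\<phi> D2\<phi> \<Omega> \<longrightarrow> x0 \<in> \<Omega> \<longrightarrow>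
        (\<forall>\<^sub>F y in nhds x0. u y - \<phi> y \<le> u x0 - \<phi> x0) \<longrightarrow>
        inf_lap_op f g x0 (u x0) (D\<phi> x0) (D2\<phi> x0) \<ge> 0)"

definition viscosity_supersolution ::
  "(real^'n) set \<Rightarrow> (real^'n \<Rightarrow> real \<Rightarrow> real) \<Rightarrow> (real \<Rightarrow> real) \<Rightarrow> (real^'n \<Rightarrow> real) \<Rightarrow> bool"
where
  "viscosity_supersolution \<Omega> f g u \<longleftrightarrow>
     (\<forall>\<phi> D\<phi> D2\<phi> x0. has_C2_derivs \<phi> D\<phi> D2\<phi> \<Omega> \<longrightarrow> x0 \<in> \<Omega> \<longrightarrow>
        (\<forall>\<^sub>F y in nhds x0. u y - \<phi> y \<ge> u x0 - \<phi> x0) \<longrightarrow>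
        inf_lap_op f g x0 (u x0) (D\<phi> x0) (D2\<phi> x0) \<le> 0)"

definition viscosity_solution_Dirichlet ::
  "(real^'n) set \<Rightarrow> (real^'n \<Rightarrow> real \<Rightarrow> real) \<Rightarrow> (real \<Rightarrow> real) \<Rightarrow> (real^'n \<Rightarrow> real) \<Rightarrow>
   (real^'n \<Rightarrow> real) \<Rightarrow> bool"
where
  "viscosity_solution_Dirichlet \<Omega> f g b u \<longleftrightarrow>
     continuous_on (closure \<Omega>) u \<and> (\<forall>x\<in>frontier \<Omega>. u x = b x) \<and>
     viscosity_subsolution \<Omega> f g u \<and> viscosity_supersolution \<Omega> f g u"

text \<open>The interval integral is oriented: for \<open>s < 0\<close> it is minus the integral over \<open>[s, 0]\<close>.\<close>

definition primitive :: "(real \<Rightarrow> real) \<Rightarrow> real \<Rightarrow> real" where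
  "primitive g s = (LBINT \<tau>=ereal 0..ereal s. g \<tau>)"

end

theory Submission
  imports Defs
begin

text \<open>
  With \<open>\<Psi> u = \<integral>\<^sub>0\<^sup>u exp (G s) ds\<close> the unknown \<open>v = \<Psi> u\<close> solves \<open>\<Delta>\<^sub>\<infinity> v + h x v = 0\<close> with
  \<open>h x (\<Psi> t) = exp (3 G t) f x t\<close>, and the growth hypothesis says that \<open>h\<close> is \<open>o(t^3)\<close> from the
  bad side. That equation is solved by Perron's method without any comparison principle between
  non-smooth functions. The functions \<open>A |x - y| - c/2 |x - y|^2\<close> have infinity-Laplacian
  \<open>- c (A - c |x - y|)^2\<close>; being smooth away from \<open>y\<close> they can be compared with arbitrary
  subsolutions by touching. With \<open>y\<close> on the boundary they are barriers, and with \<open>y\<close> in \<open>\<Omega>\<close> they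
  show that bounded subsolutions are locally Lipschitz with a common constant. So the supremum of
  all subsolutions lying below the boundary data is continuous up to the boundary, hence itself
  an element of the class, and a bump construction shows that it is a supersolution.
  A bound of \<open>v\<close> by \<open>B + s\<close> costs a right-hand side of order \<open>s^3\<close>, which is
  why subcubic growth of \<open>h\<close> allows \<open>h\<close> to be truncated.
\<close>

subsection \<open>Second-order jets\<close>

text \<open>The infinity-Laplacian of \<open>\<Psi> u\<close> is \<open>\<Psi>'^3\<close> times that
  of \<open>u\<close> plus \<open>\<Psi>'^2 * \<Psi>'' * |Du|^4\<close>. Requiring
  \<open>\<Psi>'' = g * \<Psi>'\<close> therefore produces exactly the gradient term, with the
  common factor \<open>exp (3 G)\<close>. The sign of \<open>g\<close> far out keeps
  \<open>\<Psi>'\<close> away from zero, so \<open>\<Psi>\<close> is onto and every value of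
  \<open>v\<close> can be transformed back.

  The obstacle is that \<open>h\<close> may depend on \<open>v\<close> in a non-monotone way, so
  comparison between two solutions cannot be expected. Every comparison is therefore made against a
  function whose operator has a strict sign for all values that the subsolution may take at a
  contact point. The concave term of the cones supplies this strictness: on a set of diameter at
  most \<open>R\<close>, a slope \<open>A \<ge> 2 c R\<close> leaves
  \<open>A - c |x - y| \<ge> c R\<close>, hence strength at least \<open>c^3 R^2\<close>, while the
  cone of slope \<open>2 c R\<close> is at most \<open>2 c R^2\<close> high. With
  \<open>s = 2 c R^2\<close> the strength becomes \<open>s^3 / (8 R^4)\<close>.\<close>

text \<open>The second-order part \<open>X\<close> is not required to be self-adjoint, because only
  \<open>X k \<bullet> k\<close> enters.\<close>

definition jet_above :: "('a::euclidean_space \<Rightarrow> real) \<Rightarrow> 'a \<Rightarrow> 'a \<Rightarrow> ('a \<Rightarrow> 'a) \<Rightarrow> bool" where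
  "jet_above u x p X \<longleftrightarrow> linear X \<and>
     (\<forall>e>0. \<forall>\<^sub>F k in nhds 0. u (x + k) \<le> u x + p \<bullet> k + (X k \<bullet> k) / 2 + e * (k \<bullet> k))"

definition subsol :: "'a::euclidean_space set \<Rightarrow> ('a \<Rightarrow> real \<Rightarrow> real) \<Rightarrow> ('a \<Rightarrow> real) \<Rightarrow> bool" where
  "subsol \<Omega> h v \<longleftrightarrow> (\<forall>x\<in>\<Omega>. \<forall>p X. jet_above v x p X \<longrightarrow> X p \<bullet> p + h x (v x) \<ge> 0)"

lemma subsolD: "subsol \<Omega> h v \<Longrightarrow> x \<in> \<Omega> \<Longrightarrow> jet_above v x p X \<Longrightarrow> X p \<bullet> p + h x (v x) \<ge> 0"
  unfolding subsol_def by blast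

lemma jet_above_linear: "jet_above u x p X \<Longrightarrow> linear X"
  unfolding jet_above_def by blast

lemma jet_aboveD:
  "jet_above u x p X \<Longrightarrow> e > 0 \<Longrightarrow>
    \<forall>\<^sub>F k in nhds 0. u (x + k) \<le> u x + p \<bullet> k + (X k \<bullet> k) / 2 + e * (k \<bullet> k)"
  unfolding jet_above_def by blast

lemma eventually_nhds_0_shift:
  fixes x :: "'a::real_normed_vector"
  shows "(\<forall>\<^sub>F y in nhds x. P y) \<longleftrightarrow> (\<forall>\<^sub>F k in nhds 0. P (x + k))"
proof -
  have "nhds x = filtermap (\<lambda>k. x + k) (nhds 0)"
    using filtermap_nhds_shift[of "- x" 0] by (simp add: add.commute)
  then show ?thesis by (simp add: eventually_filtermap)
qed

lemma eventually_nhds_0_norm: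
  "(\<forall>\<^sub>F k in nhds 0. P k) \<longleftrightarrow> (\<exists>d>0. \<forall>k::'a::real_normed_vector. norm k < d \<longrightarrow> P k)"
  by (simp add: eventually_nhds_metric)

lemma jet_above_touch:
  assumes "jet_above w x p X" and "\<forall>\<^sub>F k in nhds 0. v (x + k) - v x \<le> w (x + k) - w x"
  shows "jet_above v x p X"
  unfolding jet_above_def
proof (intro conjI allI impI)
  fix e :: real assume "e > 0"
  from jet_aboveD[OF assms(1) this] assms(2)
  show "\<forall>\<^sub>F k in nhds 0. v (x + k) \<le> v x + p \<bullet> k + (X k \<bullet> k) / 2 + e * (k \<bullet> k)"
    by eventually_elim simp
qed (rule jet_above_linear[OF assms(1)])

text \<open>Adding the two expansions gives \<open>0 \<le> (p - q) \<bullet> k\<close> plus half the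
  difference of the quadratic forms plus a small multiple of \<open>k \<bullet> k\<close>. Along
  \<open>k = t *\<^sub>R d\<close> with \<open>t\<close> decreasing to 0, the first order forces
  \<open>p = q\<close>, and the second order then compares the forms. This serves to check that a
  smooth function is a subsolution: each of its upper jets is controlled by a known lower
  one.\<close>

lemma jet_above_le_below:
  fixes w :: "'a::euclidean_space \<Rightarrow> real"
  assumes "jet_above w x p X" and "jet_above (\<lambda>y. - w y) x (- q) (\<lambda>k. - Y k)"
  shows "p = q" and "Y d \<bullet> d \<le> X d \<bullet> d"
proof -
  have linX: "linear X" and linY: "linear (\<lambda>k. - Y k)"
    using assms jet_above_linear by blast+
  have key: "\<forall>\<^sub>F t in at_right 0. 0 \<le> (p - q) \<bullet> d + t * ((X d \<bullet> d - Y d \<bullet> d) / 2 + e * (d \<bullet> d))"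
    if "e > 0" for e :: real and d :: 'a
  proof -
    have ev: "\<forall>\<^sub>F k in nhds 0. 0 \<le> (p - q) \<bullet> k + (X k \<bullet> k - Y k \<bullet> k) / 2 + e * (k \<bullet> k)"
      using jet_aboveD[OF assms(1) half_gt_zero[OF that]] jet_aboveD[OF assms(2) half_gt_zero[OF that]]
      by eventually_elim (simp add: inner_diff_left diff_divide_distrib algebra_simps)
    have "((\<lambda>t. t *\<^sub>R d) \<longlongrightarrow> 0 *\<^sub>R d) (at_right 0)"
      by (intro tendsto_intros)
    then have "filterlim (\<lambda>t. t *\<^sub>R d) (nhds 0) (at_right 0)"
      by simp
    with ev have "\<forall>\<^sub>F t in at_right 0. 0 \<le> (p - q) \<bullet> (t *\<^sub>R d) +
        (X (t *\<^sub>R d) \<bullet> (t *\<^sub>R d) - Y (t *\<^sub>R d) \<bullet> (t *\<^sub>R d)) / 2 + e * ((t *\<^sub>R d) \<bullet> (t *\<^sub>R d))"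
      by (rule eventually_compose_filterlim)
    moreover have "\<forall>\<^sub>F t::real in at_right 0. t > 0"
      by (rule eventually_at_right_less)
    ultimately show ?thesis
    proof eventually_elim
      case (elim t)
      have 1: "X (t *\<^sub>R d) = t *\<^sub>R X d" using linX by (simp add: linear_cmul)
      have 2: "Y (t *\<^sub>R d) = t *\<^sub>R Y d"
        using linear_cmul[OF linY, of t d] by simp
      have "0 \<le> t * ((p - q) \<bullet> d + t * ((X d \<bullet> d - Y d \<bullet> d) / 2 + e * (d \<bullet> d)))"
        using elim(1) unfolding 1 2 by (simp add: algebra_simps diff_divide_distrib)
      then show ?case using elim(2) by (simp add: zero_le_mult_iff)
    qed
  qed
  have nn: "0 \<le> (p - q) \<bullet> d" for d
  proof -
    have "((\<lambda>t. (p - q) \<bullet> d + t * ((X d \<bullet> d - Y d \<bullet> d) / 2 + 1 * (d \<bullet> d))) \<longlongrightarrow>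
        (p - q) \<bullet> d + 0 * ((X d \<bullet> d - Y d \<bullet> d) / 2 + 1 * (d \<bullet> d))) (at_right 0)"
      by (intro tendsto_intros)
    from tendsto_lowerbound[OF this key[of 1 d]] show ?thesis by simp
  qed
  from nn[of "- (p - q)"] have "(p - q) \<bullet> (p - q) \<le> 0" by (simp only: inner_minus_right neg_0_le_iff_le)
  then show pq: "p = q" using inner_ge_zero[of "p - q"] by (metis inner_eq_zero_iff order.antisym right_minus_eq)
  have "0 \<le> (X d \<bullet> d - Y d \<bullet> d) / 2 + e * (d \<bullet> d)" if "e > 0" for e :: real
  proof -
    have "\<forall>\<^sub>F t::real in at_right 0. t > 0"
      by (rule eventually_at_right_less)
    with key[OF that, of d]
    have "\<forall>\<^sub>F t::real in at_right 0. 0 \<le> (X d \<bullet> d - Y d \<bullet> d) / 2 + e * (d \<bullet> d)"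
      by eventually_elim (simp add: pq zero_le_mult_iff)
    then show ?thesis by simp
  qed
  then have *: "\<forall>\<^sub>F e in at_right 0. 0 \<le> (X d \<bullet> d - Y d \<bullet> d) / 2 + e * (d \<bullet> d)"
    by (auto simp: eventually_at_filter)
  have "((\<lambda>e. (X d \<bullet> d - Y d \<bullet> d) / 2 + e * (d \<bullet> d)) \<longlongrightarrow>
      (X d \<bullet> d - Y d \<bullet> d) / 2 + 0 * (d \<bullet> d)) (at_right 0)"
    by (intro tendsto_intros)
  from tendsto_lowerbound[OF this *] show "Y d \<bullet> d \<le> X d \<bullet> d" by simp
qed

text \<open>The mean value theorem is applied along the segment to \<open>\<phi>\<close> minus its
  candidate quadratic. The derivative of that difference is
  \<open>D (x + t *\<^sub>R k) - D x - X (t *\<^sub>R k)\<close> paired with \<open>k\<close>, which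
  is \<open>o(|k|^2)\<close> by differentiability of \<open>D\<close> at \<open>x\<close>.\<close>

lemma taylor2_peano:
  fixes \<phi> :: "'a::euclidean_space \<Rightarrow> real"
  assumes D: "\<forall>\<^sub>F y in nhds x. (\<phi> has_derivative (\<lambda>k. D y \<bullet> k)) (at y)"
    and D2: "(D has_derivative X) (at x)" and "e > 0"
  shows "\<forall>\<^sub>F k in nhds 0. \<bar>\<phi> (x + k) - \<phi> x - D x \<bullet> k - (X k \<bullet> k) / 2\<bar> \<le> e * (k \<bullet> k)"
proof -
  obtain d1 where "d1 > 0"
    and d1: "\<And>y. dist y x < d1 \<Longrightarrow> (\<phi> has_derivative (\<lambda>k. D y \<bullet> k)) (at y)"
    using D unfolding eventually_nhds_metric by blast
  obtain d2 where "d2 > 0"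
    and d2: "\<And>y. norm (y - x) < d2 \<Longrightarrow> norm (D y - D x - X (y - x)) \<le> e * norm (y - x)"
    using D2 \<open>e > 0\<close> unfolding has_derivative_at_alt by blast
  have linX: "linear X" using D2 has_derivative_linear by blast
  show ?thesis unfolding eventually_nhds_0_norm
  proof (intro exI[of _ "min d1 d2"] conjI allI impI)
    show "min d1 d2 > 0" using \<open>d1 > 0\<close> \<open>d2 > 0\<close> by simp
    fix k :: 'a assume k: "norm k < min d1 d2"
    define \<psi> where "\<psi> t = \<phi> (x + t *\<^sub>R k) - t * (D x \<bullet> k) - t^2 * ((X k \<bullet> k) / 2)" for t
    define \<psi>' where "\<psi>' t = (D (x + t *\<^sub>R k) - D x - X (t *\<^sub>R k)) \<bullet> k" for t
    have small: "norm (t *\<^sub>R k) \<le> norm k" if "0 \<le> t" "t \<le> 1" for t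
      using that by (simp add: mult_left_le_one_le)
    have der: "(\<psi> has_real_derivative \<psi>' t) (at t)" if t: "0 \<le> t" "t \<le> 1" for t
    proof -
      have "(\<phi> has_derivative (\<lambda>h. D (x + t *\<^sub>R k) \<bullet> h)) (at (x + t *\<^sub>R k))"
        using small[OF t] k by (intro d1) (simp add: dist_norm)
      then have "((\<lambda>t. \<phi> (x + t *\<^sub>R k)) has_derivative (\<lambda>h. D (x + t *\<^sub>R k) \<bullet> (h *\<^sub>R k))) (at t)"
        by (rule has_derivative_compose[rotated]) (auto intro!: derivative_eq_intros)
      then have 1: "((\<lambda>t. \<phi> (x + t *\<^sub>R k)) has_real_derivative (D (x + t *\<^sub>R k) \<bullet> k)) (at t)"
        unfolding has_field_derivative_def by (rule has_derivative_eq_rhs) (simp add: fun_eq_iff)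
      show ?thesis
        unfolding \<psi>_def \<psi>'_def
        by (rule derivative_eq_intros 1 refl)+
          (simp add: linear_cmul[OF linX] inner_diff_left)
    qed
    obtain z where z: "0 < z" "z < 1" "\<psi> 1 - \<psi> 0 = (1 - 0) * \<psi>' z"
      using MVT2[of 0 1 \<psi> \<psi>'] der by auto
    have "\<bar>\<psi>' z\<bar> \<le> norm (D (x + z *\<^sub>R k) - D x - X (z *\<^sub>R k)) * norm k"
      unfolding \<psi>'_def by (rule Cauchy_Schwarz_ineq2)
    also have "\<dots> \<le> (e * norm (z *\<^sub>R k)) * norm k"
      using d2[of "x + z *\<^sub>R k"] small[of z] z k by (intro mult_right_mono) auto
    also have "\<dots> \<le> (e * norm k) * norm k"
      using small[of z] z \<open>e > 0\<close> by (intro mult_right_mono mult_left_mono) auto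
    finally show "\<bar>\<phi> (x + k) - \<phi> x - D x \<bullet> k - (X k \<bullet> k) / 2\<bar> \<le> e * (k \<bullet> k)"
      using z(3) by (simp add: \<psi>_def algebra_simps dot_square_norm power2_eq_square)
  qed
qed

text \<open>The jet bounds \<open>\<phi> (x + k)\<close> by \<open>\<phi> x + T k\<close>, the
  increasing \<open>\<Psi>\<close> preserves this bound, and \<open>\<Psi>\<close> is then expanded
  to second order with increment \<open>T k\<close>. An upper jet says nothing from below, so
  continuity of \<open>\<phi>\<close> is what keeps \<open>\<phi> (x + k)\<close> in the interval
  where \<open>\<Psi>\<close> is monotone. The error \<open>e\<close> is shared equally between the
  jet of \<open>\<phi>\<close>, the expansion of \<open>\<Psi>\<close> and the replacement of
  \<open>T k\<close> by \<open>p \<bullet> k\<close> in the quadratic term.\<close>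

lemma jet_above_compose:
  fixes \<phi> :: "'a::euclidean_space \<Rightarrow> real"
  assumes j: "jet_above \<phi> x p X" and cont: "isCont \<phi> x"
    and der: "\<forall>\<^sub>F s in nhds (\<phi> x). (\<Psi> has_real_derivative \<Psi>' s) (at s)"
    and der2: "(\<Psi>' has_real_derivative d2) (at (\<phi> x))"
    and pos: "\<Psi>' (\<phi> x) > 0"
  shows "jet_above (\<lambda>y. \<Psi> (\<phi> y)) x (\<Psi>' (\<phi> x) *\<^sub>R p)
           (\<lambda>k. \<Psi>' (\<phi> x) *\<^sub>R X k + (d2 * (p \<bullet> k)) *\<^sub>R p)"
  unfolding jet_above_def
proof (intro conjI allI impI)
  have linX: "linear X" using j by (rule jet_above_linear)
  then show "linear (\<lambda>k. \<Psi>' (\<phi> x) *\<^sub>R X k + (d2 * (p \<bullet> k)) *\<^sub>R p)"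
    by (intro linearI) (auto simp: linear_add linear_cmul algebra_simps)
  fix e :: real assume "e > 0"
  define s0 where "s0 = \<phi> x"
  define d1 where "d1 = \<Psi>' s0"
  have "d1 > 0" using pos by (simp add: d1_def s0_def)
  have "\<forall>\<^sub>F s in nhds s0. \<Psi>' s > 0"
  proof -
    have "isCont \<Psi>' s0" using der2 unfolding s0_def by (rule DERIV_isCont)
    then have "(\<Psi>' \<longlongrightarrow> \<Psi>' s0) (nhds s0)" unfolding continuous_at tendsto_at_iff_tendsto_nhds .
    then show ?thesis by (rule order_tendstoD) (use pos in \<open>simp add: s0_def\<close>)
  qed
  with der have "\<forall>\<^sub>F s in nhds s0. (\<Psi> has_real_derivative \<Psi>' s) (at s) \<and> \<Psi>' s > 0"
    unfolding s0_def by eventually_elim simp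
  then obtain r where "r > 0"
    and r: "\<And>s. dist s s0 < r \<Longrightarrow> (\<Psi> has_real_derivative \<Psi>' s) (at s) \<and> \<Psi>' s > 0"
    unfolding eventually_nhds_metric by blast
  have mono: "\<Psi> a \<le> \<Psi> b" if "a \<le> b" "\<bar>a - s0\<bar> < r" "\<bar>b - s0\<bar> < r" for a b
  proof (rule DERIV_nonneg_imp_nondecreasing[OF that(1)])
    fix s assume "a \<le> s" "s \<le> b"
    with that have "dist s s0 < r" by (simp add: dist_real_def)
    with r[of s] show "\<exists>y. (\<Psi> has_real_derivative y) (at s) \<and> 0 \<le> y" by force
  qed
  define e1 where "e1 = e / (3 * d1)"
  have "e1 > 0" using \<open>e > 0\<close> \<open>d1 > 0\<close> by (simp add: e1_def)
  define T where "T k = p \<bullet> k + (X k \<bullet> k) / 2 + e1 * (k \<bullet> k)" for k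
  obtain CX where "CX > 0" and CX: "\<And>k. norm (X k) \<le> CX * norm k"
    using linear_bounded_pos[OF linX] by (auto simp: mult.commute)
  define C where "C = 2 * norm p + CX + e1 + 1"
  have "C > 0" using \<open>CX > 0\<close> \<open>e1 > 0\<close> by (simp add: C_def add_pos_pos add_nonneg_pos)
  have pk: "\<bar>p \<bullet> k\<bar> \<le> norm p * norm k" for k by (rule Cauchy_Schwarz_ineq2)
  have T1: "\<bar>T k - p \<bullet> k\<bar> \<le> C * (norm k)^2" for k
  proof -
    have "\<bar>X k \<bullet> k\<bar> \<le> norm (X k) * norm k" by (rule Cauchy_Schwarz_ineq2)
    also have "\<dots> \<le> CX * norm k * norm k" using CX by (intro mult_right_mono) auto
    finally have "\<bar>X k \<bullet> k\<bar> \<le> CX * (norm k)^2" by (simp add: power2_eq_square)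
    then have "\<bar>T k - p \<bullet> k\<bar> \<le> (CX + e1) * (norm k)^2"
    proof -
      have "0 \<le> e1 * (norm k)^2" "0 \<le> CX * (norm k)^2" using \<open>e1 > 0\<close> \<open>CX > 0\<close> by auto
      with \<open>\<bar>X k \<bullet> k\<bar> \<le> CX * (norm k)^2\<close> show ?thesis
        unfolding T_def dot_square_norm distrib_right by linarith
    qed
    also have "\<dots> \<le> C * (norm k)^2" by (intro mult_right_mono) (auto simp: C_def)
    finally show ?thesis .
  qed
  have T2: "\<bar>T k + p \<bullet> k\<bar> \<le> C * norm k" and T3: "\<bar>T k\<bar> \<le> C * norm k" if "norm k \<le> 1" for k
  proof -
    have "\<bar>X k \<bullet> k\<bar> \<le> norm (X k) * norm k" by (rule Cauchy_Schwarz_ineq2)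
    also have "\<dots> \<le> CX * norm k * norm k" using CX by (intro mult_right_mono) auto
    also have "\<dots> \<le> CX * norm k * 1" using that \<open>CX > 0\<close> by (intro mult_left_mono) auto
    finally have 1: "\<bar>X k \<bullet> k\<bar> \<le> CX * norm k" by simp
    have "k \<bullet> k = norm k * norm k" by (simp add: dot_square_norm power2_eq_square)
    also have "\<dots> \<le> norm k * 1" using that by (intro mult_left_mono) auto
    finally have "e1 * (k \<bullet> k) \<le> e1 * norm k" using \<open>e1 > 0\<close> by simp
    moreover have "0 \<le> e1 * (k \<bullet> k)" using \<open>e1 > 0\<close> by simp
    moreover have "0 \<le> norm p * norm k" "0 \<le> CX * norm k" "0 \<le> norm k" using \<open>CX > 0\<close> by auto
    ultimately have "\<bar>T k + p \<bullet> k\<bar> \<le> 2 * (norm p * norm k) + CX * norm k + e1 * norm k + norm k"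
      "\<bar>T k\<bar> \<le> 2 * (norm p * norm k) + CX * norm k + e1 * norm k + norm k"
      using 1 pk[of k] unfolding T_def by linarith+
    then show "\<bar>T k + p \<bullet> k\<bar> \<le> C * norm k" "\<bar>T k\<bar> \<le> C * norm k"
      by (simp_all add: C_def algebra_simps)
  qed
  define e2 where "e2 = e / (3 * C^2)"
  have "e2 > 0" using \<open>e > 0\<close> \<open>C > 0\<close> by (simp add: e2_def)
  have "\<forall>\<^sub>F t in nhds 0. \<bar>\<Psi> (s0 + t) - \<Psi> s0 - \<Psi>' s0 \<bullet> t - ((d2 * t) \<bullet> t) / 2\<bar> \<le> e2 * (t \<bullet> t)"
  proof (rule taylor2_peano[OF _ _ \<open>e2 > 0\<close>])
    show "(\<Psi>' has_derivative (*) d2) (at s0)"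
      using der2 by (simp add: s0_def has_field_derivative_def)
    show "\<forall>\<^sub>F y in nhds s0. (\<Psi> has_derivative (\<bullet>) (\<Psi>' y)) (at y)"
      using der by (simp add: s0_def has_field_derivative_def inner_real_def)
  qed
  then obtain dt where "dt > 0" and dt: "\<And>t. \<bar>t\<bar> < dt \<Longrightarrow>
      \<bar>\<Psi> (s0 + t) - \<Psi> s0 - d1 * t - d2 * t^2 / 2\<bar> \<le> e2 * t^2"
    unfolding eventually_nhds_0_norm by (auto simp: d1_def power2_eq_square mult.assoc)
  have evphi: "\<forall>\<^sub>F k in nhds 0. \<bar>\<phi> (x + k) - s0\<bar> < r"
  proof -
    have "(\<phi> \<longlongrightarrow> s0) (nhds x)"
      using cont unfolding s0_def continuous_at tendsto_at_iff_tendsto_nhds .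
    then have "\<forall>\<^sub>F y in nhds x. dist (\<phi> y) s0 < r" using \<open>r > 0\<close> by (rule tendstoD)
    then show ?thesis by (simp add: eventually_nhds_0_shift[of _ x] dist_real_def)
  qed
  \<comment> \<open>The entry \<open>1\<close> makes the bounds on \<open>T\<close> linear in
    \<open>norm k\<close>; \<open>r / C\<close> and \<open>dt / C\<close> keep \<open>T k\<close>
    where \<open>\<Psi>\<close> is monotone and where its expansion holds; the last entry absorbs
    the cubic error of replacing \<open>(T k)^2\<close> by \<open>(p \<bullet> k)^2\<close>.\<close>
  define dk where "dk = Min {1, r / C, dt / C, e / (3 * (\<bar>d2\<bar> + 1) * C^2)}"
  have "dk > 0" using \<open>C > 0\<close> \<open>r > 0\<close> \<open>dt > 0\<close> \<open>e > 0\<close> by (simp add: dk_def)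
  have evk: "\<forall>\<^sub>F k::'a in nhds 0. norm k < dk"
    unfolding eventually_nhds_0_norm using \<open>dk > 0\<close> by blast
  from jet_aboveD[OF j \<open>e1 > 0\<close>] evphi evk
  show "\<forall>\<^sub>F k in nhds 0. \<Psi> (\<phi> (x + k)) \<le> \<Psi> (\<phi> x) + (\<Psi>' (\<phi> x) *\<^sub>R p) \<bullet> k +
      ((\<Psi>' (\<phi> x) *\<^sub>R X k + (d2 * (p \<bullet> k)) *\<^sub>R p) \<bullet> k) / 2 + e * (k \<bullet> k)"
  proof eventually_elim
    case (elim k)
    have k: "norm k < 1" "norm k < r / C" "norm k < dt / C"
      "norm k < e / (3 * (\<bar>d2\<bar> + 1) * C^2)"
      using elim(3) by (simp_all add: dk_def)
    have Tk: "\<bar>T k\<bar> \<le> C * norm k" "\<bar>T k + p \<bullet> k\<bar> \<le> C * norm k" using T2 T3 k(1) by auto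
    have "C * norm k < r" "C * norm k < dt"
      using k(2,3) \<open>C > 0\<close> by (simp_all add: field_simps)
    with Tk have Tr: "\<bar>T k\<bar> < r" "\<bar>T k\<bar> < dt" by auto
    have "\<Psi> (\<phi> (x + k)) \<le> \<Psi> (s0 + T k)"
      using elim(1,2) Tr by (intro mono) (auto simp: T_def s0_def)
    also have "\<dots> \<le> \<Psi> s0 + d1 * T k + d2 * (T k)^2 / 2 + e2 * (T k)^2"
      using dt[OF Tr(2)] by linarith
    also have "e2 * (T k)^2 \<le> e / 3 * (norm k)^2"
    proof -
      have "(T k)^2 \<le> (C * norm k)^2" using Tk(1) by (metis abs_ge_zero power2_abs power_mono)
      then have "e2 * (T k)^2 \<le> e2 * (C * norm k)^2" using \<open>e2 > 0\<close> by simp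
      also have "\<dots> = e / 3 * (norm k)^2" using \<open>C > 0\<close> by (simp add: e2_def power_mult_distrib)
      finally show ?thesis .
    qed
    also have "d2 * (T k)^2 / 2 \<le> d2 * (p \<bullet> k)^2 / 2 + e / 3 * (norm k)^2"
    proof -
      have "\<bar>d2 * ((T k)^2 - (p \<bullet> k)^2)\<bar> = \<bar>d2\<bar> * (\<bar>T k - p \<bullet> k\<bar> * \<bar>T k + p \<bullet> k\<bar>)"
        by (simp add: abs_mult[symmetric] power2_eq_square algebra_simps)
      also have "\<dots> \<le> (\<bar>d2\<bar> + 1) * ((C * (norm k)^2) * (C * norm k))"
        using T1[of k] Tk(2) \<open>C > 0\<close> by (intro mult_mono) auto
      also have "\<dots> = (\<bar>d2\<bar> + 1) * C^2 * norm k * (norm k)^2"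
        by (simp add: power2_eq_square)
      also have "\<dots> \<le> e / 3 * (norm k)^2"
      proof (rule mult_right_mono)
        have "0 < 3 * (\<bar>d2\<bar> + 1) * C^2" using \<open>C > 0\<close> by (simp add: add_nonneg_pos)
        then have "norm k * (3 * (\<bar>d2\<bar> + 1) * C^2) < e" using k(4) by (simp only: pos_less_divide_eq)
        then show "(\<bar>d2\<bar> + 1) * C\<^sup>2 * norm k \<le> e / 3" by (simp add: algebra_simps)
      qed simp
      finally have "d2 * ((T k)^2 - (p \<bullet> k)^2) \<le> e / 3 * (norm k)^2" by linarith
      moreover have "0 \<le> e / 3 * (norm k)^2" using \<open>e > 0\<close> by simp
      ultimately show ?thesis by (simp add: right_diff_distrib)
    qed
    also have "d1 * T k = d1 * (p \<bullet> k) + d1 * (X k \<bullet> k) / 2 + e / 3 * (norm k)^2"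
      using \<open>d1 > 0\<close> by (simp add: T_def e1_def dot_square_norm field_simps)
    finally show ?case
      by (simp add: s0_def[symmetric] d1_def[symmetric] dot_square_norm inner_add_left
          power2_eq_square add_divide_distrib algebra_simps)
  qed
qed

subsection \<open>Suprema and bumps of subsolutions\<close>

text \<open>This is the gradient at \<open>k\<close> of
  \<open>p \<bullet> k + (X k \<bullet> k) / 2\<close>. The adjoint appears because \<open>X\<close>
  may fail to be self-adjoint.\<close>

definition quad_grad :: "'a::euclidean_space \<Rightarrow> ('a \<Rightarrow> 'a) \<Rightarrow> 'a \<Rightarrow> 'a" where
  "quad_grad p X k = p + (1/2) *\<^sub>R (X k + adjoint X k)"

lemma quad_expand:
  fixes p :: "'a::euclidean_space"
  assumes X: "linear X"
  shows "p \<bullet> (k + l) + (X (k + l) \<bullet> (k + l)) / 2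
    = p \<bullet> k + (X k \<bullet> k) / 2 + quad_grad p X k \<bullet> l + (X l \<bullet> l) / 2"
proof -
  have "X l \<bullet> k = l \<bullet> adjoint X k" using adjoint_works[OF X, of l k] by simp
  also have "\<dots> = adjoint X k \<bullet> l" by (rule inner_commute)
  finally have *: "X l \<bullet> k = adjoint X k \<bullet> l" .
  show ?thesis
    by (simp add: quad_grad_def linear_add[OF X] inner_add_left inner_add_right * field_simps)
qed

lemma jet_above_quadratic:
  fixes p :: "'a::euclidean_space"
  assumes X: "linear X"
    and q: "\<forall>\<^sub>F l in nhds 0. v (x + k + l) - v (x + k) \<le>
      (p \<bullet> (k + l) + (X (k + l) \<bullet> (k + l)) / 2) - (p \<bullet> k + (X k \<bullet> k) / 2)"
  shows "jet_above v (x + k) (quad_grad p X k) X"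
  unfolding jet_above_def
proof (intro conjI allI impI X)
  fix e :: real assume "e > 0"
  then have *: "0 \<le> e * (l \<bullet> l)" for l :: 'a by simp
  show "\<forall>\<^sub>F l in nhds 0. v (x + k + l) \<le> v (x + k) + quad_grad p X k \<bullet> l + (X l \<bullet> l) / 2 + e * (l \<bullet> l)"
    using q
  proof eventually_elim
    case (elim l)
    then show ?case using *[of l] quad_expand[OF X, of p k l] by linarith
  qed
qed

text \<open>A strict sign of the operator at \<open>x\<close> and \<open>t0\<close> thus persists at
  contact points that have moved a little and whose value differs a little from
  \<open>t0\<close>.\<close>

lemma quad_operator_tendsto:
  fixes \<Omega> :: "'a::euclidean_space set"
  assumes "open \<Omega>" "x \<in> \<Omega>" and X: "linear X"
    and cont: "continuous_on (\<Omega> \<times> UNIV) (\<lambda>(x, t). h x t)"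
  shows "((\<lambda>(k, t). X (quad_grad p X k) \<bullet> quad_grad p X k + h (x + k) t)
    \<longlongrightarrow> X p \<bullet> p + h x t0) (nhds (0, t0 :: real))"
proof -
  have "isCont (\<lambda>(x, t). h x t) (x, t0)"
    using continuous_on_interior[OF cont, of "(x, t0)"] assms(1,2)
    by (simp add: interior_open open_Times)
  then have h: "((\<lambda>(x, t). h x t) \<longlongrightarrow> h x t0) (nhds (x, t0))"
    unfolding continuous_at tendsto_at_iff_tendsto_nhds by simp
  have lim: "((\<lambda>z. (x + fst z, snd z)) \<longlongrightarrow> (x + fst (0::'a, t0), snd (0::'a, t0))) (nhds (0, t0))"
    by (intro tendsto_intros filterlim_ident)
  have "((\<lambda>z. h (x + fst z) (snd z)) \<longlongrightarrow> h x t0) (nhds (0, t0))"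
    using filterlim_compose[OF h, of "\<lambda>z. (x + fst z, snd z)"] lim by simp
  moreover have "((\<lambda>z. X (quad_grad p X (fst z)) \<bullet> quad_grad p X (fst z)) \<longlongrightarrow> X p \<bullet> p) (nhds (0, t0))"
  proof -
    have fs: "(fst \<longlongrightarrow> (0::'a)) (nhds (0::'a, t0))"
      using tendsto_fst[OF filterlim_ident, of "(0::'a, t0)"] by simp
    have bX: "bounded_linear X" "bounded_linear (adjoint X)"
      using X adjoint_linear linear_conv_bounded_linear by blast+
    have 1: "((\<lambda>z. X (fst z)) \<longlongrightarrow> X 0) (nhds (0::'a, t0))"
      by (rule bounded_linear.tendsto[OF bX(1) fs])
    have 2: "((\<lambda>z. adjoint X (fst z)) \<longlongrightarrow> adjoint X 0) (nhds (0::'a, t0))"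
      by (rule bounded_linear.tendsto[OF bX(2) fs])
    have "((\<lambda>z. quad_grad p X (fst z)) \<longlongrightarrow> p + (1/2) *\<^sub>R (X 0 + adjoint X 0)) (nhds (0::'a, t0))"
      unfolding quad_grad_def by (intro tendsto_intros 1 2)
    then have "((\<lambda>z. quad_grad p X (fst z)) \<longlongrightarrow> p) (nhds (0::'a, t0))"
      by (simp add: linear_0[OF X] linear_0[OF adjoint_linear[OF X]])
    then show ?thesis by (intro tendsto_inner bounded_linear.tendsto[OF bX(1)])
  qed
  ultimately have "((\<lambda>z. X (quad_grad p X (fst z)) \<bullet> quad_grad p X (fst z) + h (x + fst z) (snd z))
      \<longlongrightarrow> X p \<bullet> p + h x t0) (nhds (0, t0))"
    by (rule tendsto_add[rotated])
  then show ?thesis by (simp add: case_prod_unfold)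
qed

lemma eventually_nhds_pairE:
  fixes t0 :: real
  assumes "\<forall>\<^sub>F z in nhds (0::'a::euclidean_space, t0). P z"
  obtains d where "d > 0" "\<And>k t. norm k < d \<Longrightarrow> \<bar>t - t0\<bar> < d \<Longrightarrow> P (k, t)"
proof -
  from assms obtain d where "d > 0" and d: "\<And>z. dist z (0, t0) < d \<Longrightarrow> P z"
    unfolding eventually_nhds_metric by blast
  show thesis
  proof (rule that[of "d/2"])
    fix k :: 'a and t assume "norm k < d/2" "\<bar>t - t0\<bar> < d/2"
    moreover have "dist (k, t) (0, t0) \<le> norm k + \<bar>t - t0\<bar>"
      using norm_Pair_le[of k "t - t0"] by (simp add: dist_norm)
    ultimately show "P (k, t)" by (intro d) linarith
  qed (use \<open>d > 0\<close> in simp)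
qed

lemma linear_add_scaled_id: "linear X \<Longrightarrow> linear (\<lambda>k. X k + c *\<^sub>R k)"
  by (intro linearI) (auto simp: linear_add linear_cmul algebra_simps)

text \<open>The supremum need not be continuous here: touching a competitor \<open>v\<close> instead of the
  supremum moves the contact point only by \<open>O(sqrt \<epsilon>)\<close> because the test quadratic has been
  made strict by \<open>\<eta> * (k \<bullet> k)\<close>.\<close>

lemma subsol_Sup:
  fixes \<Omega> :: "'a::euclidean_space set"
  assumes "open \<Omega>" and cont: "continuous_on (\<Omega> \<times> UNIV) (\<lambda>(x, t). h x t)"
    and "S \<noteq> {}" and vcont: "\<And>v. v \<in> S \<Longrightarrow> continuous_on \<Omega> v"
    and sub: "\<And>v. v \<in> S \<Longrightarrow> subsol \<Omega> h v"
    and bdd: "\<And>x. x \<in> \<Omega> \<Longrightarrow> bdd_above ((\<lambda>v. v x) ` S)"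
  shows "subsol \<Omega> h (\<lambda>x. SUP v\<in>S. v x)"
  unfolding subsol_def
proof (intro ballI allI impI)
  define u where "u x = (SUP v\<in>S. v x)" for x
  fix x p X assume x: "x \<in> \<Omega>" and "jet_above (\<lambda>x. SUP v\<in>S. v x) x p X"
  then have j: "jet_above u x p X" by (simp add: u_def[abs_def])
  have linX: "linear X" using j by (rule jet_above_linear)
  have "0 \<le> X p \<bullet> p + h x (u x)"
  proof (rule ccontr)
    assume "\<not> 0 \<le> X p \<bullet> p + h x (u x)"
    then have neg: "X p \<bullet> p + h x (u x) < 0" by simp
    \<comment> \<open>The quadratic will gain \<open>2 * \<eta> * (k \<bullet> k)\<close>: one half
      absorbs the jet error, the other makes the contact strict. This raises the operator by
      \<open>4 * \<eta> * (p \<bullet> p)\<close>, less than half of its distance to zero.\<close>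
    define \<eta> where "\<eta> = - (X p \<bullet> p + h x (u x)) / (8 * (p \<bullet> p + 1))"
    have pp: "p \<bullet> p + 1 > 0" by (simp add: add_nonneg_pos)
    have "\<eta> > 0" using neg pp by (simp add: \<eta>_def divide_neg_pos)
    define Y where "Y k = X k + (4 * \<eta>) *\<^sub>R k" for k
    have linY: "linear Y" unfolding Y_def[abs_def] by (rule linear_add_scaled_id[OF linX])
    have "\<eta> * (8 * (p \<bullet> p + 1)) = - (X p \<bullet> p + h x (u x))"
      using pp by (simp add: \<eta>_def)
    then have "Y p \<bullet> p + h x (u x) < 0"
      using neg \<open>\<eta> > 0\<close> by (simp add: Y_def inner_add_left algebra_simps)
    with quad_operator_tendsto[OF \<open>open \<Omega>\<close> x linY cont, of p "u x"]
    have "\<forall>\<^sub>F z in nhds (0, u x). (case z of (k, t) \<Rightarrow> Y (quad_grad p Y k) \<bullet> quad_grad p Y k + h (x + k) t) < 0"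
      by (rule order_tendstoD(2))
    then obtain d where "d > 0" and d: "\<And>k t. norm k < d \<Longrightarrow> \<bar>t - u x\<bar> < d \<Longrightarrow>
        Y (quad_grad p Y k) \<bullet> quad_grad p Y k + h (x + k) t < 0"
      by (rule eventually_nhds_pairE) auto
    define q where "q k = p \<bullet> k + (Y k \<bullet> k) / 2" for k
    have qcont: "continuous_on UNIV q"
      unfolding q_def using linear_continuous_on[of Y UNIV] linY
      by (intro continuous_intros) (simp_all add: linear_conv_bounded_linear)
    have "\<forall>\<^sub>F k in nhds 0. \<bar>q k\<bar> < d / 2"
    proof -
      have "(q \<longlongrightarrow> q 0) (nhds 0)"
        using qcont by (simp add: continuous_on_eq_continuous_at continuous_at tendsto_at_iff_tendsto_nhds)
      moreover have "q 0 = 0" by (simp add: q_def linear_0[OF linY])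
      ultimately have "\<forall>\<^sub>F k in nhds 0. dist (q k) 0 < d / 2"
        using tendstoD[of q "q 0" "nhds 0" "d/2"] \<open>d > 0\<close> by simp
      then show ?thesis by simp
    qed
    moreover have "\<forall>\<^sub>F k in nhds 0. x + k \<in> \<Omega>"
      using eventually_nhds_in_open[OF \<open>open \<Omega>\<close> x] by (simp add: eventually_nhds_0_shift[of _ x])
    moreover have "\<forall>\<^sub>F k::'a in nhds 0. norm k < d"
      unfolding eventually_nhds_0_norm using \<open>d > 0\<close> by blast
    moreover note jet_aboveD[OF j \<open>\<eta> > 0\<close>]
    ultimately have "\<forall>\<^sub>F k in nhds 0. \<bar>q k\<bar> < d / 2 \<and> x + k \<in> \<Omega> \<and> norm k < d \<and>
        u (x + k) \<le> u x + q k - \<eta> * (k \<bullet> k)"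
      by eventually_elim (simp add: q_def Y_def inner_add_left field_simps)
    then obtain r0 where "r0 > 0" and r0: "\<And>k. norm k < r0 \<Longrightarrow> \<bar>q k\<bar> < d / 2 \<and> x + k \<in> \<Omega> \<and> norm k < d \<and>
        u (x + k) \<le> u x + q k - \<eta> * (k \<bullet> k)"
      unfolding eventually_nhds_0_norm by blast
    define r where "r = r0 / 2"
    have "r > 0" and r: "\<And>k. norm k \<le> r \<Longrightarrow> norm k < r0" using \<open>r0 > 0\<close> by (auto simp: r_def)
    \<comment> \<open>The bound \<open>\<eta> * r^2\<close> keeps the contact point off the sphere
      of radius \<open>r\<close>, where strictness outweighs the loss from replacing
      \<open>u\<close> by \<open>v\<close>. The bound \<open>d / 2\<close> keeps the value of
      \<open>v\<close> at the contact point within \<open>d\<close> of \<open>u x\<close>, where the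
      operator is still negative.\<close>
    define \<epsilon> where "\<epsilon> = min (d / 2) (\<eta> * r^2)"
    have "\<epsilon> > 0" using \<open>d > 0\<close> \<open>\<eta> > 0\<close> \<open>r > 0\<close> by (simp add: \<epsilon>_def)
    obtain v where "v \<in> S" and v: "u x - \<epsilon> < v x"
      using less_cSUP_iff[OF \<open>S \<noteq> {}\<close> bdd[OF x], of "u x - \<epsilon>"] \<open>\<epsilon> > 0\<close> by (auto simp: u_def)
    have vu: "v y \<le> u y" if "y \<in> \<Omega>" for y
      unfolding u_def by (rule cSUP_upper[OF \<open>v \<in> S\<close> bdd[OF that]])
    have "y \<in> \<Omega>" if "dist x y \<le> r" for y
      using r0[of "y - x"] r[of "y - x"] that by (simp add: dist_norm norm_minus_commute)
    then have "continuous_on (cball 0 r) (\<lambda>k. v (x + k) - q k)"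
      by (intro continuous_intros continuous_on_compose2[OF vcont[OF \<open>v \<in> S\<close>]]
          continuous_on_subset[OF qcont]) auto
    then obtain k0 where k0: "norm k0 \<le> r"
      and max: "\<And>k. norm k \<le> r \<Longrightarrow> v (x + k) - q k \<le> v (x + k0) - q k0"
      using continuous_attains_sup[of "cball 0 r" "\<lambda>k. v (x + k) - q k"] \<open>r > 0\<close> by auto
    have k0': "\<bar>q k0\<bar> < d / 2" "x + k0 \<in> \<Omega>" "norm k0 < d" "u (x + k0) \<le> u x + q k0 - \<eta> * (k0 \<bullet> k0)"
      using r0[OF r[OF k0]] by auto
    have low: "v x \<le> v (x + k0) - q k0"
      using max[of 0] \<open>r > 0\<close> by (simp add: q_def linear_0[OF linY])
    have "\<eta> * (norm k0)^2 < \<epsilon>"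
      using low v k0'(4) vu[OF k0'(2)] unfolding dot_square_norm by linarith
    also have "\<dots> \<le> \<eta> * r^2" by (simp add: \<epsilon>_def)
    finally have "norm k0 < r"
      using \<open>\<eta> > 0\<close> \<open>r > 0\<close> by (simp add: power2_less_imp_less)
    have "jet_above v (x + k0) (quad_grad p Y k0) Y"
    proof (rule jet_above_quadratic[OF linY])
      have "\<forall>\<^sub>F l::'a in nhds 0. norm l < r - norm k0"
        unfolding eventually_nhds_0_norm using \<open>norm k0 < r\<close> by (intro exI[of _ "r - norm k0"]) auto
      then show "\<forall>\<^sub>F l in nhds 0. v (x + k0 + l) - v (x + k0) \<le>
        (p \<bullet> (k0 + l) + (Y (k0 + l) \<bullet> (k0 + l)) / 2) - (p \<bullet> k0 + (Y k0 \<bullet> k0) / 2)"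
      proof eventually_elim
        case (elim l)
        then have "norm (k0 + l) \<le> r" using norm_triangle_ineq[of k0 l] by linarith
        from max[OF this] show ?case by (simp add: q_def add.assoc)
      qed
    qed
    from subsolD[OF sub[OF \<open>v \<in> S\<close>] k0'(2) this]
    have "0 \<le> Y (quad_grad p Y k0) \<bullet> quad_grad p Y k0 + h (x + k0) (v (x + k0))" .
    moreover have "\<bar>v (x + k0) - u x\<bar> < d"
    proof -
      have "0 \<le> \<eta> * (k0 \<bullet> k0)" using \<open>\<eta> > 0\<close> by simp
      moreover have "\<epsilon> \<le> d / 2" by (simp add: \<epsilon>_def)
      ultimately show ?thesis using low v k0' vu[OF k0'(2)] by linarith
    qed
    ultimately show False using d[OF k0'(3)] by force
  qed
  then show "0 \<le> X p \<bullet> p + h x (SUP v\<in>S. v x)" by (simp add: u_def)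
qed

lemma subsol_max:
  assumes "subsol \<Omega> h v" "subsol \<Omega> h w"
  shows "subsol \<Omega> h (\<lambda>x. max (v x) (w x))"
  unfolding subsol_def
proof (intro ballI allI impI)
  fix x p X assume x: "x \<in> \<Omega>" and j: "jet_above (\<lambda>x. max (v x) (w x)) x p X"
  show "0 \<le> X p \<bullet> p + h x (max (v x) (w x))"
  proof (cases "v x \<le> w x")
    case True
    then have "jet_above w x p X" by (intro jet_above_touch[OF j] always_eventually) auto
    from subsolD[OF assms(2) x this] True show ?thesis by (simp add: max_absorb2)
  next
    case False
    then have "jet_above v x p X" by (intro jet_above_touch[OF j] always_eventually) auto
    from subsolD[OF assms(1) x this] False show ?thesis by (simp add: max_absorb1)
  qed
qed

text \<open>An upper jet of \<open>- u\<close> that violates the reflected inequality yields, after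
  negation, a slight tightening and a lift by \<open>\<delta>\<close>, a quadratic that is a strict
  subsolution in a small ball. It exceeds \<open>u\<close> at the centre and lies below
  \<open>u\<close> near the rim, so the maximum of the two, taken only in the ball, is again a
  continuous subsolution. Continuity is tracked on a set \<open>D\<close> larger than
  \<open>\<Omega>\<close> so that the new function can be a competitor up to the boundary.\<close>

lemma subsol_bump:
  fixes \<Omega> :: "'a::euclidean_space set"
  assumes "open \<Omega>" and cont: "continuous_on (\<Omega> \<times> UNIV) (\<lambda>(x, t). h x t)"
    and sub: "subsol \<Omega> h u" and ucont: "continuous_on D u" and "\<Omega> \<subseteq> D"
    and nsup: "\<not> subsol \<Omega> (\<lambda>x t. - h x (- t)) (\<lambda>x. - u x)"
  obtains w x0 where "subsol \<Omega> h w" "continuous_on D w" "\<And>x. u x \<le> w x"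
    "\<And>x. x \<notin> \<Omega> \<Longrightarrow> w x = u x" "x0 \<in> \<Omega>" "u x0 < w x0"
proof -
  from nsup obtain x p X where x: "x \<in> \<Omega>" and j: "jet_above (\<lambda>x. - u x) x p X"
    and neg: "X p \<bullet> p - h x (u x) < 0"
    unfolding subsol_def by auto
  have linX: "linear X" using j by (rule jet_above_linear)
  define \<eta> where "\<eta> = (h x (u x) - X p \<bullet> p) / (8 * (p \<bullet> p + 1))"
  have pp: "p \<bullet> p + 1 > 0" by (simp add: add_nonneg_pos)
  have "\<eta> > 0" using neg pp by (simp add: \<eta>_def)
  define Y where "Y k = - (X k + (4 * \<eta>) *\<^sub>R k)" for k
  have linY: "linear Y"
    unfolding Y_def[abs_def] by (intro linear_compose_neg linear_add_scaled_id[OF linX])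
  have "\<eta> * (8 * (p \<bullet> p + 1)) = h x (u x) - X p \<bullet> p"
    using pp by (simp add: \<eta>_def)
  then have "0 < Y (- p) \<bullet> (- p) + h x (u x)"
    using neg \<open>\<eta> > 0\<close> by (simp add: Y_def inner_add_left linear_neg[OF linX] algebra_simps)
  with quad_operator_tendsto[OF \<open>open \<Omega>\<close> x linY cont, of "- p" "u x"]
  have "\<forall>\<^sub>F z in nhds (0, u x). 0 < (case z of (k, t) \<Rightarrow>
      Y (quad_grad (- p) Y k) \<bullet> quad_grad (- p) Y k + h (x + k) t)"
    by (rule order_tendstoD(1))
  then obtain d where "d > 0" and d: "\<And>k t. norm k < d \<Longrightarrow> \<bar>t - u x\<bar> < d \<Longrightarrow>
      0 < Y (quad_grad (- p) Y k) \<bullet> quad_grad (- p) Y k + h (x + k) t"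
    by (rule eventually_nhds_pairE) auto
  define q where "q k = (- p) \<bullet> k + (Y k \<bullet> k) / 2" for k
  have qcont: "continuous_on UNIV q"
    unfolding q_def using linear_continuous_on[of Y UNIV] linY
    by (intro continuous_intros) (simp_all add: linear_conv_bounded_linear)
  have "\<forall>\<^sub>F k in nhds 0. \<bar>q k\<bar> < d / 2"
  proof -
    have "(q \<longlongrightarrow> q 0) (nhds 0)"
      using qcont by (simp add: continuous_on_eq_continuous_at continuous_at tendsto_at_iff_tendsto_nhds)
    moreover have "q 0 = 0" by (simp add: q_def linear_0[OF linY])
    ultimately have "\<forall>\<^sub>F k in nhds 0. dist (q k) 0 < d / 2"
      using tendstoD[of q "q 0" "nhds 0" "d/2"] \<open>d > 0\<close> by simp
    then show ?thesis by simp
  qed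
  moreover have "\<forall>\<^sub>F k in nhds 0. x + k \<in> \<Omega>"
    using eventually_nhds_in_open[OF \<open>open \<Omega>\<close> x] by (simp add: eventually_nhds_0_shift[of _ x])
  moreover have "\<forall>\<^sub>F k::'a in nhds 0. norm k < d"
    unfolding eventually_nhds_0_norm using \<open>d > 0\<close> by blast
  moreover note jet_aboveD[OF j \<open>\<eta> > 0\<close>]
  ultimately have "\<forall>\<^sub>F k in nhds 0. \<bar>q k\<bar> < d / 2 \<and> x + k \<in> \<Omega> \<and> norm k < d \<and>
      u x + q k + \<eta> * (k \<bullet> k) \<le> u (x + k)"
    by eventually_elim (simp add: q_def Y_def inner_diff_left field_simps)
  then obtain r where "r > 0" and r: "\<And>k. norm k < r \<Longrightarrow> \<bar>q k\<bar> < d / 2 \<and> x + k \<in> \<Omega> \<and> norm k < d \<and>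
      u x + q k + \<eta> * (k \<bullet> k) \<le> u (x + k)"
    unfolding eventually_nhds_0_norm by blast
  \<comment> \<open>The bound \<open>\<eta> * (r/2)^2\<close> leaves the lifted quadratic below
    \<open>u\<close> on the annulus between \<open>r/2\<close> and \<open>r\<close>;
    \<open>d / 2\<close>, together with the bound on \<open>q\<close>, keeps its values in the range
    where the operator is positive.\<close>
  define \<delta> where "\<delta> = min (d / 2) (\<eta> * (r/2)^2)"
  have "\<delta> > 0" "\<delta> \<le> d / 2" "\<delta> \<le> \<eta> * (r/2)^2"
    using \<open>d > 0\<close> \<open>\<eta> > 0\<close> \<open>r > 0\<close> by (simp_all add: \<delta>_def)
  define Q where "Q y = u x + q (y - x) + \<delta>" for y
  have Qcont: "continuous_on A Q" for A
    unfolding Q_def by (intro continuous_intros continuous_on_compose2[OF qcont]) auto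
  define w where "w y = (if y \<in> ball x r then max (u y) (Q y) else u y)" for y
  have outer: "Q y \<le> u y" if "r/2 \<le> norm (y - x)" "norm (y - x) < r" for y
  proof -
    have "(r/2)^2 \<le> (norm (y - x))^2" using that \<open>r > 0\<close> by (intro power_mono) auto
    then have "\<delta> \<le> \<eta> * ((y - x) \<bullet> (y - x))"
      using \<open>\<delta> \<le> \<eta> * (r/2)^2\<close> \<open>\<eta> > 0\<close> unfolding dot_square_norm
      by (meson mult_left_mono order_less_imp_le order_trans)
    then show ?thesis using r[OF that(2)] by (simp add: Q_def)
  qed
  have ballsub: "ball x r \<subseteq> \<Omega>"
  proof
    fix y assume "y \<in> ball x r"
    then show "y \<in> \<Omega>" using r[of "y - x"] by (simp add: dist_norm norm_minus_commute)
  qed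
  have weq: "w y = u y" if "y \<notin> ball x (r/2)" for y
    using that outer[of y] by (auto simp: w_def dist_norm norm_minus_commute)
  have uw: "u y \<le> w y" for y by (simp add: w_def)
  have wcont: "continuous_on D w"
  proof -
    \<comment> \<open>The ball of radius \<open>r\<close> and the complement of the closed ball of
      half that radius are open and overlap in the annulus where \<open>w = u\<close>, so continuity
      can be shown on each piece.\<close>
    have "D \<subseteq> ball x r \<union> - cball x (r/2)" using \<open>r > 0\<close> by auto
    moreover have "continuous_on (D \<inter> ball x r) w"
    proof -
      have "continuous_on (D \<inter> ball x r) (\<lambda>y. max (u y) (Q y))"
        by (intro continuous_intros Qcont continuous_on_subset[OF ucont]) auto
      then show ?thesis by (rule continuous_on_eq) (auto simp: w_def)
    qed
    moreover have "continuous_on (D \<inter> - cball x (r/2)) w"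
    proof -
      have "continuous_on (D \<inter> - cball x (r/2)) u"
        by (rule continuous_on_subset[OF ucont]) auto
      then show ?thesis by (rule continuous_on_eq) (auto simp: weq)
    qed
    ultimately have "continuous_on (D \<inter> ball x r \<union> D \<inter> - cball x (r/2)) w"
      by (intro continuous_on_Un_local_open) (auto simp: openin_open)
    moreover have "D \<inter> ball x r \<union> D \<inter> - cball x (r/2) = D"
      using \<open>D \<subseteq> ball x r \<union> - cball x (r/2)\<close> by auto
    ultimately show ?thesis by simp
  qed
  have wsub: "subsol \<Omega> h w"
    unfolding subsol_def
  proof (intro ballI allI impI)
    fix y P Z assume y: "y \<in> \<Omega>" and jw: "jet_above w y P Z"
    show "0 \<le> Z P \<bullet> P + h y (w y)"
    proof (cases "w y = u y")
      case True
      have "jet_above u y P Z"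
        using uw True by (intro jet_above_touch[OF jw] always_eventually) auto
      from subsolD[OF sub y this] True show ?thesis by simp
    next
      case False
      then have yb: "y \<in> ball x r" and wQ: "w y = Q y" and "u y < Q y"
        by (auto simp: w_def split: if_splits)
      have jQ: "jet_above Q y P Z"
      proof (rule jet_above_touch[OF jw])
        have "\<forall>\<^sub>F z in nhds y. z \<in> ball x r"
          using yb by (intro eventually_nhds_in_open) auto
        then have "\<forall>\<^sub>F z in nhds y. Q z - Q y \<le> w z - w y"
          by eventually_elim (simp add: wQ, simp add: w_def)
        then show "\<forall>\<^sub>F k in nhds 0. Q (y + k) - Q y \<le> w (y + k) - w y"
          by (simp add: eventually_nhds_0_shift[of _ y])
      qed
      define k where "k = y - x"
      have k: "norm k < r" "y = x + k" using yb by (simp_all add: k_def dist_norm norm_minus_commute)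
      have "jet_above (\<lambda>z. - Q z) (x + k) (quad_grad p (\<lambda>k. - Y k) k) (\<lambda>k. - Y k)"
        by (rule jet_above_quadratic)
          (auto intro!: always_eventually linear_compose_neg[OF linY] simp: Q_def q_def add.assoc)
      moreover have "quad_grad p (\<lambda>k. - Y k) k = - quad_grad (- p) Y k"
      proof -
        have "adjoint (\<lambda>k. - Y k) = (\<lambda>k. - adjoint Y k)"
          by (rule adjoint_unique) (simp add: adjoint_works[OF linY])
        then show ?thesis by (simp add: quad_grad_def algebra_simps)
      qed
      ultimately have "jet_above (\<lambda>z. - Q z) y (- quad_grad (- p) Y k) (\<lambda>k. - Y k)"
        by (simp add: k)
      from jet_above_le_below[OF jQ this]
      have "P = quad_grad (- p) Y k" "Y P \<bullet> P \<le> Z P \<bullet> P" by auto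
      moreover have "0 < Y (quad_grad (- p) Y k) \<bullet> quad_grad (- p) Y k + h (x + k) (w y)"
        using r[OF k(1)] \<open>\<delta> > 0\<close> \<open>\<delta> \<le> d / 2\<close> unfolding wQ
        by (intro d) (auto simp: Q_def k(2))
      ultimately show ?thesis using k(2) by simp
    qed
  qed
  have "u x < w x"
    using \<open>\<delta> > 0\<close> \<open>r > 0\<close> by (simp add: w_def Q_def q_def linear_0[OF linY])
  moreover have "w y = u y" if "y \<notin> \<Omega>" for y
    using that ballsub by (auto simp: w_def)
  ultimately show thesis using that[of w x] wsub wcont uw x by blast
qed

subsection \<open>Barriers and the Perron function\<close>

text \<open>The function sending \<open>t\<close> to \<open>- \<Psi> (- t)\<close> still has
  positive derivative, and its second derivative changes sign, so the chain rule for upper jets can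
  be applied to \<open>- \<phi>\<close>.\<close>

lemma jet_below_compose:
  fixes \<phi> :: "'a::euclidean_space \<Rightarrow> real"
  assumes j: "jet_above (\<lambda>y. - \<phi> y) x (- p) (\<lambda>k. - X k)" and cont: "isCont \<phi> x"
    and der: "\<forall>\<^sub>F s in nhds (\<phi> x). (\<Psi> has_real_derivative \<Psi>' s) (at s)"
    and der2: "(\<Psi>' has_real_derivative d2) (at (\<phi> x))"
    and pos: "\<Psi>' (\<phi> x) > 0"
  shows "jet_above (\<lambda>y. - \<Psi> (\<phi> y)) x (- (\<Psi>' (\<phi> x) *\<^sub>R p))
           (\<lambda>k. - (\<Psi>' (\<phi> x) *\<^sub>R X k + (d2 * (p \<bullet> k)) *\<^sub>R p))"
proof -
  have "jet_above (\<lambda>y. (\<lambda>t. - \<Psi> (- t)) (- \<phi> y)) x ((\<lambda>t. \<Psi>' (- t)) (- \<phi> x) *\<^sub>R (- p))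
     (\<lambda>k. (\<lambda>t. \<Psi>' (- t)) (- \<phi> x) *\<^sub>R (- X k) + ((- d2) * ((- p) \<bullet> k)) *\<^sub>R (- p))"
  proof (rule jet_above_compose[OF j])
    show "isCont (\<lambda>y. - \<phi> y) x" using cont by (intro continuous_intros)
    have "filterlim uminus (nhds (\<phi> x)) (nhds (- \<phi> x))"
      using tendsto_minus[OF filterlim_ident, of "- \<phi> x"] by simp
    with der have "\<forall>\<^sub>F s in nhds (- \<phi> x). (\<Psi> has_real_derivative \<Psi>' (- s)) (at (- s))"
      by (rule eventually_compose_filterlim)
    then show "\<forall>\<^sub>F s in nhds (- \<phi> x). ((\<lambda>t. - \<Psi> (- t)) has_real_derivative \<Psi>' (- s)) (at s)"
    proof eventually_elim
      case (elim s)
      have "((\<lambda>t. \<Psi> (- t)) has_real_derivative - \<Psi>' (- s)) (at s)"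
        using elim by (simp add: DERIV_mirror)
      from DERIV_minus[OF this] show ?case by simp
    qed
    show "((\<lambda>t. \<Psi>' (- t)) has_real_derivative - d2) (at (- \<phi> x))"
      using der2 by (simp add: DERIV_mirror)
  qed (use pos in simp)
  then show ?thesis by (simp add: algebra_simps)
qed

definition cone_fn :: "real \<Rightarrow> real \<Rightarrow> 'a::euclidean_space \<Rightarrow> 'a \<Rightarrow> real" where
  "cone_fn A c y x = A * norm (x - y) - c / 2 * (norm (x - y))\<^sup>2"

lemma cone_self [simp]: "cone_fn A c y y = 0"
  by (simp add: cone_fn_def)

lemma continuous_on_cone [continuous_intros]: "continuous_on S (cone_fn A c y)"
  unfolding cone_fn_def by (intro continuous_intros)

lemma cone_le: "0 \<le> c \<Longrightarrow> cone_fn A c y x \<le> A * norm (x - y)"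
  by (simp add: cone_fn_def)

lemma cone_ge:
  assumes "c * norm (x - y) \<le> A"
  shows "A / 2 * norm (x - y) \<le> cone_fn A c y x"
proof -
  have "c * norm (x - y) * norm (x - y) \<le> A * norm (x - y)"
    using assms by (intro mult_right_mono) auto
  then show ?thesis by (simp add: cone_fn_def power2_eq_square)
qed

text \<open>Near \<open>x\<close> the cone is an increasing function of the polynomial
  \<open>|x - y|^2\<close>, so the chain rules give matching upper and lower jets. The condition
  \<open>c * norm (x - y) < A\<close> is positivity of the radial derivative, and the operator value
  is the radial formula: that derivative squared times the second radial derivative
  \<open>- c\<close>.\<close>

lemma cone_jets:
  fixes x y :: "'a::euclidean_space"
  assumes "x \<noteq> y" "c * norm (x - y) < A"
  obtains p X where "jet_above (cone_fn A c y) x p X"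
    "jet_above (\<lambda>z. - cone_fn A c y z) x (- p) (\<lambda>k. - X k)"
    "X p \<bullet> p = - c * (A - c * norm (x - y))\<^sup>2"
proof -
  define \<phi> where "\<phi> z = (z - y) \<bullet> (z - y)" for z :: 'a
  define \<Psi> where "\<Psi> s = A * sqrt s - c / 2 * s" for s
  define \<Psi>' where "\<Psi>' s = A / (2 * sqrt s) - c / 2" for s
  define r where "r = norm (x - y)"
  have "r > 0" using assms by (simp add: r_def)
  have \<phi>x: "\<phi> x = r^2" by (simp add: \<phi>_def r_def dot_square_norm)
  have sq: "sqrt (\<phi> z) = norm (z - y)" for z by (simp add: \<phi>_def norm_eq_sqrt_inner)
  have coneeq: "cone_fn A c y = (\<lambda>z. \<Psi> (\<phi> z))"
    by (simp add: fun_eq_iff cone_fn_def \<Psi>_def sq) (simp add: \<phi>_def dot_square_norm)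
  define d2 where "d2 = - A / (4 * r^3)"
  define p where "p = 2 *\<^sub>R (x - y)"
  define X where "X k = 2 *\<^sub>R k" for k :: 'a
  have linX: "linear X" "linear (\<lambda>k. - X k)"
    unfolding X_def by (auto intro!: linearI simp: algebra_simps)
  have exp: "\<phi> (x + k) = \<phi> x + p \<bullet> k + X k \<bullet> k / 2" for k
    by (simp add: \<phi>_def p_def X_def inner_add_left inner_add_right inner_diff_left inner_diff_right
        inner_commute algebra_simps)
  have j1: "jet_above \<phi> x p X" and j2: "jet_above (\<lambda>z. - \<phi> z) x (- p) (\<lambda>k. - X k)"
    unfolding jet_above_def using linX
    by (auto simp: exp intro!: always_eventually)
  have cont: "isCont \<phi> x" unfolding \<phi>_def by (intro continuous_intros)
  have pos: "\<forall>\<^sub>F s in nhds (\<phi> x). s > 0"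
    using \<open>r > 0\<close> eventually_nhds_in_open[of "{0<..}" "\<phi> x"] by (simp add: \<phi>x)
  have der: "\<forall>\<^sub>F s in nhds (\<phi> x). (\<Psi> has_real_derivative \<Psi>' s) (at s)"
    using pos
  proof eventually_elim
    case (elim s)
    then show ?case unfolding \<Psi>_def \<Psi>'_def
      by (auto intro!: derivative_eq_intros simp: field_simps)
  qed
  have der2: "(\<Psi>' has_real_derivative d2) (at (\<phi> x))"
    unfolding \<Psi>'_def d2_def \<phi>x using \<open>r > 0\<close>
    by (auto intro!: derivative_eq_intros simp: field_simps power2_eq_square power3_eq_cube)
  have \<Psi>'x: "\<Psi>' (\<phi> x) = (A - c * r) / (2 * r)"
    using \<open>r > 0\<close> by (simp add: \<Psi>'_def \<phi>x field_simps)
  then have "\<Psi>' (\<phi> x) > 0" using assms(2) \<open>r > 0\<close> by (simp add: r_def)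
  note jets = jet_above_compose[OF j1 cont der der2 this] jet_below_compose[OF j2 cont der der2 this]
  define P where "P = \<Psi>' (\<phi> x) *\<^sub>R p"
  define Z where "Z k = \<Psi>' (\<phi> x) *\<^sub>R X k + (d2 * (p \<bullet> k)) *\<^sub>R p" for k
  have pp: "p \<bullet> p = 4 * r^2" by (simp add: p_def r_def dot_square_norm)
  have "Z P \<bullet> P = (\<Psi>' (\<phi> x))^2 * (p \<bullet> p) * (2 * \<Psi>' (\<phi> x) + d2 * (p \<bullet> p))"
    by (simp add: Z_def P_def X_def inner_add_left power2_eq_square algebra_simps)
  also have "\<dots> = - c * (A - c * r)\<^sup>2"
    unfolding pp \<Psi>'x d2_def using \<open>r > 0\<close>
    by (simp add: field_simps power2_eq_square power3_eq_cube)
  finally have "Z P \<bullet> P = - c * (A - c * norm (x - y))\<^sup>2" by (simp add: r_def)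
  then show thesis
    using jets that[of P Z] by (simp add: coneeq P_def Z_def[abs_def])
qed

section \<open>Comparison by touching and the interior Lipschitz estimate\<close>

lemma jet_above_add_const:
  assumes "jet_above u x p X" shows "jet_above (\<lambda>y. a + u y) x p X"
  using assms by (rule jet_above_touch) simp

text \<open>At a positive maximum of \<open>v - w\<close> the upper jet of \<open>w\<close> is one
  of \<open>v\<close>, against the subsolution property. Strictness is required at the value
  \<open>v x\<close> and not at \<open>w x\<close>, so \<open>h\<close> may depend on its second
  argument in any way. Requiring it only where \<open>w x < v x\<close> lets boundary points and the
  vertex of a cone be excluded by comparing values.\<close>

lemma subsol_comparison:
  fixes v :: "'a::euclidean_space \<Rightarrow> real"
  assumes "compact C" "continuous_on C v" "continuous_on C w" "subsol \<Omega> h v"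
    and strict: "\<And>x. x \<in> C \<Longrightarrow> w x < v x \<Longrightarrow>
      x \<in> \<Omega> \<and> x \<in> interior C \<and> (\<exists>p X. jet_above w x p X \<and> X p \<bullet> p + h x (v x) < 0)"
    and "x \<in> C"
  shows "v x \<le> w x"
proof (rule ccontr)
  assume "\<not> v x \<le> w x"
  obtain z where z: "z \<in> C" and max: "\<And>y. y \<in> C \<Longrightarrow> v y - w y \<le> v z - w z"
    using continuous_attains_sup[of C "\<lambda>x. v x - w x"] assms(1-3) \<open>x \<in> C\<close>
    by (auto intro!: continuous_intros)
  have "w z < v z" using max[OF \<open>x \<in> C\<close>] \<open>\<not> v x \<le> w x\<close> by simp
  from strict[OF z this] obtain p X where "z \<in> \<Omega>" "z \<in> interior C" and j: "jet_above w z p X"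
    and neg: "X p \<bullet> p + h z (v z) < 0" by blast
  have "\<forall>\<^sub>F y in nhds z. y \<in> interior C"
    using \<open>z \<in> interior C\<close> by (intro eventually_nhds_in_open) auto
  then have "\<forall>\<^sub>F y in nhds z. v y - v z \<le> w y - w z"
  proof eventually_elim
    case (elim y)
    then show ?case using max[of y] interior_subset[of C] by auto
  qed
  then have "jet_above v z p X"
    by (intro jet_above_touch[OF j]) (simp add: eventually_nhds_0_shift[of _ z])
  from subsolD[OF assms(4) \<open>z \<in> \<Omega>\<close> this] neg show False by simp
qed

text \<open>The cone with \<open>c = 1\<close> issuing from the value \<open>v y\<close> at
  \<open>y\<close> dominates \<open>v\<close> on the ball. The summand \<open>4 * N / \<rho>\<close>
  of its slope lifts it by \<open>2 * N\<close>, a bound for the oscillation of \<open>v\<close>, on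
  the sphere; the rest keeps the radial derivative at least \<open>K + 1\<close>, whose square beats
  \<open>h\<close>. At the non-smooth vertex both functions agree. The constant uses only bounds
  that a whole family can share.\<close>

lemma subsol_lipschitz:
  fixes v :: "'a::euclidean_space \<Rightarrow> real"
  assumes sub: "subsol \<Omega> h v" and cont: "continuous_on \<Omega> v" and "\<rho> > 0" and ball: "cball y \<rho> \<subseteq> \<Omega>"
    and bd: "\<And>x. x \<in> \<Omega> \<Longrightarrow> \<bar>v x\<bar> \<le> N" and K: "\<And>x. x \<in> \<Omega> \<Longrightarrow> h x (v x) \<le> K" and "K \<ge> 0"
    and x: "x \<in> cball y \<rho>"
  shows "v x \<le> v y + (2 * \<rho> + K + 1 + 4 * N / \<rho>) * norm (x - y)"
proof -
  define A where "A = 2 * \<rho> + K + 1 + 4 * N / \<rho>"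
  have y: "y \<in> \<Omega>" using ball \<open>\<rho> > 0\<close> by auto
  have "N \<ge> 0" using bd[OF y] by linarith
  then have "4 * N / \<rho> \<ge> 0" using \<open>\<rho> > 0\<close> by simp
  then have A: "A \<ge> \<rho> + K + 1" "A \<ge> 4 * N / \<rho>" using \<open>\<rho> > 0\<close> \<open>K \<ge> 0\<close> by (auto simp: A_def)
  have "v x \<le> v y + cone_fn A 1 y x"
  proof (rule subsol_comparison[OF compact_cball _ _ sub _ x])
    show "continuous_on (cball y \<rho>) v" using cont ball by (rule continuous_on_subset)
    show "continuous_on (cball y \<rho>) (\<lambda>z. v y + cone_fn A 1 y z)" by (intro continuous_intros)
    fix z assume z: "z \<in> cball y \<rho>" and gt: "v y + cone_fn A 1 y z < v z"
    have "z \<in> \<Omega>" using z ball by auto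
    have nz: "norm (z - y) \<le> \<rho>" using z by (simp add: dist_norm norm_minus_commute)
    have "z \<noteq> y" using gt by auto
    have "norm (z - y) \<noteq> \<rho>"
    proof
      assume eq: "norm (z - y) = \<rho>"
      have "4 * N \<le> A * \<rho>" using A(2) \<open>\<rho> > 0\<close> by (simp add: field_simps)
      then have "2 * N \<le> cone_fn A 1 y z"
        using cone_ge[of 1 z y A] A(1) \<open>K \<ge> 0\<close> eq by simp
      then show False using bd[OF y] bd[OF \<open>z \<in> \<Omega>\<close>] gt by linarith
    qed
    then have "z \<in> interior (cball y \<rho>)" using nz by (simp add: dist_norm norm_minus_commute)
    moreover have "1 * norm (z - y) < A" using nz A(1) \<open>K \<ge> 0\<close> by simp
    then obtain p X where "jet_above (cone_fn A 1 y) z p X" and X: "X p \<bullet> p = - 1 * (A - 1 * norm (z - y))\<^sup>2"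
      by (rule cone_jets[OF \<open>z \<noteq> y\<close>])
    then have "jet_above (\<lambda>x. v y + cone_fn A 1 y x) z p X" by (intro jet_above_add_const)
    moreover have "X p \<bullet> p + h z (v z) < 0"
    proof -
      have "K + 1 \<le> A - norm (z - y)" using nz A(1) by simp
      then have "(K + 1) * 1 \<le> (A - norm (z - y)) * (A - norm (z - y))"
        using \<open>K \<ge> 0\<close> by (intro mult_mono) auto
      then show ?thesis using X K[OF \<open>z \<in> \<Omega>\<close>] by (simp add: power2_eq_square)
    qed
    ultimately show "z \<in> \<Omega> \<and> z \<in> interior (cball y \<rho>) \<and>
        (\<exists>p X. jet_above (\<lambda>z. v y + cone_fn A 1 y z) z p X \<and> X p \<bullet> p + h z (v z) < 0)"
      using \<open>z \<in> \<Omega>\<close> by blast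
  qed
  with cone_le[of 1 A y x] show ?thesis by (simp add: A_def)
qed

text \<open>Here \<open>c^3 * R^2\<close> is the guaranteed strength of a cone of slope at least
  \<open>2 * c * R\<close>. The two strict bounds on \<open>h\<close> are one-sided because upper
  barriers are used at values at least \<open>- B\<close> and lower ones at values at most
  \<open>B\<close>. The bound \<open>K\<close> feeds the interior Lipschitz estimate.\<close>

locale dirichlet_barriers =
  fixes \<Omega> :: "'a::euclidean_space set" and b :: "'a \<Rightarrow> real" and h :: "'a \<Rightarrow> real \<Rightarrow> real"
    and c R B K :: real
  assumes open_\<Omega>: "open \<Omega>" and bounded_\<Omega>: "bounded \<Omega>" and nonempty: "\<Omega> \<noteq> {}"
    and b_cont: "continuous_on (frontier \<Omega>) b"
    and b_bound: "\<And>x. x \<in> frontier \<Omega> \<Longrightarrow> \<bar>b x\<bar> \<le> B"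
    and c_pos: "c > 0" and R_pos: "R > 0"
    and diam: "\<And>x y. x \<in> closure \<Omega> \<Longrightarrow> y \<in> closure \<Omega> \<Longrightarrow> norm (x - y) \<le> R"
    and h_cont: "continuous_on (\<Omega> \<times> UNIV) (\<lambda>(x, t). h x t)"
    and h_upper: "\<And>x t. x \<in> \<Omega> \<Longrightarrow> - B \<le> t \<Longrightarrow> h x t < c^3 * R^2"
    and h_lower: "\<And>x t. x \<in> \<Omega> \<Longrightarrow> t \<le> B \<Longrightarrow> - (c^3 * R^2) < h x t"
    and h_bound: "\<And>x t. x \<in> \<Omega> \<Longrightarrow> h x t \<le> K"
begin

text \<open>The floor bounds all members, and not only their supremum, from below, which a common
  Lipschitz constant requires. It is a lower bound for \<open>- B - cone_fn (2 * c * R) c y\<close>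
  on the closure, because that cone rises by at most \<open>2 * c * R * R\<close>.\<close>

definition perron_class :: "('a \<Rightarrow> real) set" where
  "perron_class = {v. continuous_on (closure \<Omega>) v \<and> (\<forall>x\<in>frontier \<Omega>. v x \<le> b x) \<and>
     (\<forall>x\<in>closure \<Omega>. - B - 2 * c * R^2 \<le> v x) \<and> subsol \<Omega> h v}"

definition perron_fun :: "'a \<Rightarrow> real" where
  "perron_fun x = (SUP v\<in>perron_class. v x)"

lemma frontier_nonempty: obtains y where "y \<in> frontier \<Omega>"
  using frontier_not_empty[OF nonempty] bounded_\<Omega> not_bounded_UNIV by blast

lemma frontier_closure: "x \<in> frontier \<Omega> \<Longrightarrow> x \<in> closure \<Omega>"
  by (simp add: frontier_def)

lemma closure_cases: "x \<in> closure \<Omega> \<Longrightarrow> x \<notin> \<Omega> \<Longrightarrow> x \<in> frontier \<Omega>"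
  by (simp add: frontier_def interior_open[OF open_\<Omega>])

lemma frontier_disjoint: "x \<in> frontier \<Omega> \<Longrightarrow> x \<notin> \<Omega>"
  by (simp add: frontier_def interior_open[OF open_\<Omega>])

lemma \<Omega>_interior: "x \<in> \<Omega> \<Longrightarrow> x \<in> interior (closure \<Omega>)"
  using interior_maximal[OF closure_subset open_\<Omega>] by blast

lemma B_nonneg: "B \<ge> 0"
  using frontier_nonempty b_bound by (metis abs_ge_zero order_trans)

lemma slope_bounds:
  assumes "2 * c * R \<le> A" "x \<in> closure \<Omega>" "y \<in> closure \<Omega>"
  shows "c * norm (x - y) < A" "c^3 * R^2 \<le> c * (A - c * norm (x - y))^2" "0 \<le> cone_fn A c y x"
proof -
  have 1: "c * norm (x - y) \<le> c * R" using diam[OF assms(2,3)] c_pos by simp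
  have 2: "0 < c * R" using c_pos R_pos by simp
  show 3: "c * norm (x - y) < A" using 1 2 assms(1) by linarith
  have "(c * R)^2 \<le> (A - c * norm (x - y))^2" using 1 2 assms(1) by (intro power_mono) auto
  then have "c * (c * R)^2 \<le> c * (A - c * norm (x - y))^2" using c_pos by simp
  then show "c^3 * R^2 \<le> c * (A - c * norm (x - y))^2"
    by (simp add: power_mult_distrib power2_eq_square power3_eq_cube algebra_simps)
  have "0 \<le> A / 2 * norm (x - y)" using 1 2 assms(1) by simp
  also have "\<dots> \<le> cone_fn A c y x" using 3 by (intro cone_ge) simp
  finally show "0 \<le> cone_fn A c y x" .
qed

text \<open>The vertex lies on the boundary, so the cone is smooth throughout
  \<open>\<Omega>\<close>. Where \<open>v\<close> exceeds the barrier its value is above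
  \<open>a \<ge> - B\<close>, the range in which the strength of the cone dominates
  \<open>h\<close>.\<close>

lemma upper_barrier:
  assumes v: "v \<in> perron_class" and A: "2 * c * R \<le> A" and y: "y \<in> frontier \<Omega>" and a: "- B \<le> a"
    and bd: "\<And>z. z \<in> frontier \<Omega> \<Longrightarrow> b z \<le> a + cone_fn A c y z" and x: "x \<in> closure \<Omega>"
  shows "v x \<le> a + cone_fn A c y x"
proof (rule subsol_comparison[where C = "closure \<Omega>" and \<Omega> = \<Omega> and h = h])
  show "compact (closure \<Omega>)" using bounded_\<Omega> by simp
  show "continuous_on (closure \<Omega>) v" "subsol \<Omega> h v" using v by (auto simp: perron_class_def)
  show "continuous_on (closure \<Omega>) (\<lambda>x. a + cone_fn A c y x)" by (intro continuous_intros)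
  fix z assume z: "z \<in> closure \<Omega>" and gt: "a + cone_fn A c y z < v z"
  have "z \<in> \<Omega>"
  proof (rule ccontr)
    assume "z \<notin> \<Omega>"
    then have "z \<in> frontier \<Omega>" using z by (intro closure_cases)
    then have "v z \<le> b z" using v by (auto simp: perron_class_def)
    with bd[OF \<open>z \<in> frontier \<Omega>\<close>] gt show False by simp
  qed
  note sl = slope_bounds[OF A z frontier_closure[OF y]]
  have "z \<noteq> y" using \<open>z \<in> \<Omega>\<close> frontier_disjoint[OF y] by auto
  then obtain p X where j: "jet_above (cone_fn A c y) z p X"
    and X: "X p \<bullet> p = - c * (A - c * norm (z - y))\<^sup>2"
    by (rule cone_jets[OF _ sl(1)])
  have "h z (v z) < c^3 * R^2" using gt sl(3) a by (intro h_upper[OF \<open>z \<in> \<Omega>\<close>]) simp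
  then have "X p \<bullet> p + h z (v z) < 0" using X sl(2) by simp
  then show "z \<in> \<Omega> \<and> z \<in> interior (closure \<Omega>) \<and>
      (\<exists>p X. jet_above (\<lambda>x. a + cone_fn A c y x) z p X \<and> X p \<bullet> p + h z (v z) < 0)"
    using \<open>z \<in> \<Omega>\<close> \<Omega>_interior jet_above_add_const[OF j] by blast
qed (rule x)

text \<open>The second-order term of the operator is odd, so reflecting the cone reverses the sign
  of its strength, which then outweighs \<open>h\<close> at values at most \<open>B\<close>.
  Arbitrary upper jets are compared with the exact lower jet.\<close>

lemma lower_cone_subsol:
  assumes A: "2 * c * R \<le> A" and y: "y \<in> frontier \<Omega>" and a: "a \<le> B"
  shows "subsol \<Omega> h (\<lambda>x. a - cone_fn A c y x)"
  unfolding subsol_def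
proof (intro ballI allI impI)
  fix x P Z assume x: "x \<in> \<Omega>" and jZ: "jet_above (\<lambda>x. a - cone_fn A c y x) x P Z"
  have xc: "x \<in> closure \<Omega>" using x closure_subset by blast
  note sl = slope_bounds[OF A xc frontier_closure[OF y]]
  have "x \<noteq> y" using x frontier_disjoint[OF y] by auto
  then obtain p X where j: "jet_above (cone_fn A c y) x p X"
    and X: "X p \<bullet> p = - c * (A - c * norm (x - y))\<^sup>2"
    by (rule cone_jets[OF _ sl(1)])
  have "jet_above (\<lambda>x. - (a - cone_fn A c y x)) x (- (- p)) (\<lambda>k. - (- X k))"
    using jet_above_add_const[OF j, of "- a"] by simp
  from jet_above_le_below(1)[OF jZ this] jet_above_le_below(2)[OF jZ this, of P]
  have P: "P = - p" "- X P \<bullet> P \<le> Z P \<bullet> P" by simp_all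
  have "X P = - X p" using P(1) linear_neg[OF jet_above_linear[OF j]] by simp
  then have "- (X p \<bullet> p) \<le> Z P \<bullet> P" using P by simp
  moreover have "- (c^3 * R^2) < h x (a - cone_fn A c y x)"
    using a sl(3) by (intro h_lower[OF x]) simp
  ultimately show "0 \<le> Z P \<bullet> P + h x (a - cone_fn A c y x)" using X sl(2) by simp
qed

text \<open>A steep cone may drop below the floor of the class; the maximum with the reflected cone
  of slope \<open>2 * c * R\<close> prevents this and still lies below the boundary data.\<close>

lemma lower_barrier:
  assumes A: "2 * c * R \<le> A" and y: "y \<in> frontier \<Omega>" and a: "a \<le> B"
    and bd: "\<And>z. z \<in> frontier \<Omega> \<Longrightarrow> a - cone_fn A c y z \<le> b z"
  shows "(\<lambda>x. max (a - cone_fn A c y x) (- B - cone_fn (2 * c * R) c y x)) \<in> perron_class"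
  unfolding perron_class_def
proof (safe)
  show "continuous_on (closure \<Omega>) (\<lambda>x. max (a - cone_fn A c y x) (- B - cone_fn (2 * c * R) c y x))"
    by (intro continuous_intros)
  show "subsol \<Omega> h (\<lambda>x. max (a - cone_fn A c y x) (- B - cone_fn (2 * c * R) c y x))"
    using B_nonneg by (intro subsol_max lower_cone_subsol assms) auto
next
  fix x assume x: "x \<in> frontier \<Omega>"
  have "0 \<le> cone_fn (2 * c * R) c y x"
    by (intro slope_bounds frontier_closure x y) simp
  with bd[OF x] b_bound[OF x] show "max (a - cone_fn A c y x) (- B - cone_fn (2 * c * R) c y x) \<le> b x"
    by (simp add: abs_le_iff)
next
  fix x assume x: "x \<in> closure \<Omega>"
  have "cone_fn (2 * c * R) c y x \<le> 2 * c * R * norm (x - y)"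
    using c_pos by (intro cone_le) simp
  also have "\<dots> \<le> 2 * c * R * R"
    using diam[OF x frontier_closure[OF y]] c_pos R_pos by (intro mult_left_mono) auto
  finally show "- B - 2 * c * R^2 \<le> max (a - cone_fn A c y x) (- B - cone_fn (2 * c * R) c y x)"
    by (simp add: power2_eq_square)
qed

section \<open>Bounds, boundary values and continuity of the supremum\<close>

lemma perron_class_nonempty: "perron_class \<noteq> {}"
proof -
  obtain y where y: "y \<in> frontier \<Omega>" by (rule frontier_nonempty)
  have "- B - cone_fn (2 * c * R) c y z \<le> b z" if "z \<in> frontier \<Omega>" for z
    using slope_bounds(3)[of "2 * c * R" z y] frontier_closure y that b_bound[OF that] by fastforce
  with lower_barrier[of "2 * c * R" y "- B"] y B_nonneg show ?thesis by fastforce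
qed

lemma perron_class_bounds:
  assumes v: "v \<in> perron_class" and x: "x \<in> closure \<Omega>"
  shows "\<bar>v x\<bar> \<le> B + 2 * c * R^2"
proof -
  obtain y where y: "y \<in> frontier \<Omega>" by (rule frontier_nonempty)
  have "v x \<le> B + cone_fn (2 * c * R) c y x"
  proof (rule upper_barrier[OF v _ y _ _ x])
    show "b z \<le> B + cone_fn (2 * c * R) c y z" if "z \<in> frontier \<Omega>" for z
      using slope_bounds(3)[of "2 * c * R" z y] frontier_closure y that b_bound[OF that] by fastforce
  qed (use B_nonneg in auto)
  also have "cone_fn (2 * c * R) c y x \<le> 2 * c * R * norm (x - y)"
    using c_pos by (intro cone_le) simp
  also have "\<dots> \<le> 2 * c * R * R"
    using diam[OF x frontier_closure[OF y]] c_pos R_pos by (intro mult_left_mono) auto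
  finally have "v x \<le> B + 2 * c * R^2" by (simp add: power2_eq_square)
  moreover have "- B - 2 * c * R^2 \<le> v x" using v x by (auto simp: perron_class_def)
  ultimately show ?thesis by linarith
qed

lemma perron_bdd: "x \<in> closure \<Omega> \<Longrightarrow> bdd_above ((\<lambda>v. v x) ` perron_class)"
  using perron_class_bounds by (intro bdd_aboveI2[of _ _ "B + 2 * c * R^2"]) (auto simp: abs_le_iff)

lemma perron_upper: "x \<in> closure \<Omega> \<Longrightarrow> v \<in> perron_class \<Longrightarrow> v x \<le> perron_fun x"
  unfolding perron_fun_def by (intro cSUP_upper perron_bdd)

lemma perron_least: "(\<And>v. v \<in> perron_class \<Longrightarrow> v x \<le> a) \<Longrightarrow> perron_fun x \<le> a"
  unfolding perron_fun_def by (intro cSUP_least perron_class_nonempty)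

lemma perron_bounds:
  assumes x: "x \<in> closure \<Omega>"
  shows "\<bar>perron_fun x\<bar> \<le> B + 2 * c * R^2"
proof -
  obtain v where v: "v \<in> perron_class" using perron_class_nonempty by blast
  have "perron_fun x \<le> B + 2 * c * R^2"
    using perron_class_bounds[OF _ x] by (intro perron_least) (auto simp: abs_le_iff)
  moreover have "v x \<le> perron_fun x" by (rule perron_upper[OF x v])
  ultimately show ?thesis using perron_class_bounds[OF v x] by linarith
qed

lemma perron_subsol: "subsol \<Omega> h perron_fun"
  unfolding perron_fun_def[abs_def]
  using closure_subset[of \<Omega>]
  by (intro subsol_Sup open_\<Omega> h_cont perron_class_nonempty perron_bdd)
    (auto simp: perron_class_def intro: continuous_on_subset)

text \<open>One slope serves all boundary points: for close points uniform continuity gives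
  \<open>\<epsilon>\<close>, and from distance \<open>d\<close> on the summand
  \<open>4 * B / d\<close> raises the cone to at least \<open>2 * B\<close>, which bounds the
  oscillation of \<open>b\<close>.\<close>

lemma modulus:
  assumes "\<epsilon> > 0"
  obtains A where "2 * c * R \<le> A"
    "\<And>y z. y \<in> frontier \<Omega> \<Longrightarrow> z \<in> frontier \<Omega> \<Longrightarrow> \<bar>b y - b z\<bar> \<le> \<epsilon> + cone_fn A c y z"
proof -
  have "compact (frontier \<Omega>)" using bounded_\<Omega> by (rule compact_frontier_bounded)
  with b_cont have "uniformly_continuous_on (frontier \<Omega>) b" by (rule compact_uniformly_continuous)
  then obtain d where "d > 0" and d: "\<And>y z. y \<in> frontier \<Omega> \<Longrightarrow> z \<in> frontier \<Omega> \<Longrightarrow>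
      norm (z - y) < d \<Longrightarrow> \<bar>b z - b y\<bar> < \<epsilon>"
    using assms unfolding uniformly_continuous_on_def dist_norm by force
  define A where "A = 2 * c * R + 4 * B / d"
  have A: "2 * c * R \<le> A" "4 * B / d \<le> A"
    using \<open>d > 0\<close> B_nonneg c_pos R_pos by (auto simp: A_def)
  show thesis
  proof (rule that[OF A(1)])
    fix y z assume yz: "y \<in> frontier \<Omega>" "z \<in> frontier \<Omega>"
    note sl = slope_bounds[OF A(1) frontier_closure[OF yz(2)] frontier_closure[OF yz(1)]]
    show "\<bar>b y - b z\<bar> \<le> \<epsilon> + cone_fn A c y z"
    proof (cases "norm (z - y) < d")
      case True
      with d[OF yz] sl(3) show ?thesis by (simp add: abs_minus_commute)
    next
      case False
      have "4 * B \<le> A * d" using A(2) \<open>d > 0\<close> by (simp add: field_simps)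
      also have "\<dots> \<le> A * norm (z - y)"
        using False A(1) c_pos R_pos by (intro mult_left_mono) (auto intro: order_trans[rotated])
      finally have "2 * B \<le> cone_fn A c y z" using cone_ge[OF less_imp_le[OF sl(1)]] by simp
      then show ?thesis using b_bound[OF yz(1)] b_bound[OF yz(2)] assms by linarith
    qed
  qed
qed

text \<open>The cone starting from \<open>b y + \<epsilon>\<close> bounds every member from above;
  the reflected cone from \<open>b y - \<epsilon>\<close> yields a member and so bounds the supremum
  from below.\<close>

lemma perron_near_boundary:
  assumes "\<epsilon> > 0" "y \<in> frontier \<Omega>"
  obtains A where "\<And>x. x \<in> closure \<Omega> \<Longrightarrow> \<bar>perron_fun x - b y\<bar> \<le> \<epsilon> + cone_fn A c y x"
proof -
  obtain A where A: "2 * c * R \<le> A" and mod: "\<And>y z. y \<in> frontier \<Omega> \<Longrightarrow> z \<in> frontier \<Omega> \<Longrightarrow>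
      \<bar>b y - b z\<bar> \<le> \<epsilon> + cone_fn A c y z"
    using modulus[OF assms(1)] by blast
  show thesis
  proof (rule that[of A])
    fix x assume x: "x \<in> closure \<Omega>"
    have side: "- B \<le> b y + \<epsilon>" "b y - \<epsilon> \<le> B"
      using b_bound[OF assms(2)] assms(1) by linarith+
    have bz: "b z \<le> (b y + \<epsilon>) + cone_fn A c y z" "(b y - \<epsilon>) - cone_fn A c y z \<le> b z"
      if "z \<in> frontier \<Omega>" for z
      using mod[OF assms(2) that] by linarith+
    have "perron_fun x \<le> (b y + \<epsilon>) + cone_fn A c y x"
      by (rule perron_least, rule upper_barrier[OF _ A assms(2) side(1) bz(1) x])
    moreover
    have "(\<lambda>x. max ((b y - \<epsilon>) - cone_fn A c y x) (- B - cone_fn (2 * c * R) c y x)) \<in> perron_class"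
      by (rule lower_barrier[OF A assms(2) side(2) bz(2)])
    from perron_upper[OF x this] have "(b y - \<epsilon>) - cone_fn A c y x \<le> perron_fun x" by simp
    ultimately show "\<bar>perron_fun x - b y\<bar> \<le> \<epsilon> + cone_fn A c y x" by linarith
  qed
qed

lemma perron_boundary:
  assumes y: "y \<in> frontier \<Omega>"
  shows "perron_fun y = b y"
proof -
  have "\<bar>perron_fun y - b y\<bar> \<le> 0 + \<epsilon>" if eps: "\<epsilon> > 0" for \<epsilon>
  proof -
    obtain A where "\<And>x. x \<in> closure \<Omega> \<Longrightarrow> \<bar>perron_fun x - b y\<bar> \<le> \<epsilon> + cone_fn A c y x"
      using perron_near_boundary[OF eps y] by blast
    from this[OF frontier_closure[OF y]] show ?thesis by simp
  qed
  then have "\<bar>perron_fun y - b y\<bar> \<le> 0" by (rule field_le_epsilon)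
  then show ?thesis by simp
qed

text \<open>In \<open>\<Omega>\<close> the one-sided Lipschitz estimate with a common constant
  survives the supremum, and exchanging the two points makes it two-sided. At the boundary the
  barriers squeeze the supremum.\<close>

lemma perron_continuous: "continuous_on (closure \<Omega>) perron_fun"
  unfolding continuous_on_def
proof
  fix x assume x: "x \<in> closure \<Omega>"
  show "(perron_fun \<longlongrightarrow> perron_fun x) (at x within closure \<Omega>)"
  proof (cases "x \<in> \<Omega>")
    case True
    then obtain \<rho>0 where "\<rho>0 > 0" and \<rho>0: "cball x \<rho>0 \<subseteq> \<Omega>"
      using open_contains_cball[of \<Omega>] open_\<Omega> by blast
    \<comment> \<open>Halving keeps the closed ball of radius \<open>\<rho>\<close> about each
      nearby \<open>y\<close> inside \<open>\<Omega>\<close>, as the estimate is applied with either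
      point as centre.\<close>
    define \<rho> where "\<rho> = \<rho>0 / 2"
    have "\<rho> > 0" using \<open>\<rho>0 > 0\<close> by (simp add: \<rho>_def)
    define N where "N = B + 2 * c * R^2"
    define L where "L = 2 * \<rho> + max K 0 + 1 + 4 * N / \<rho>"
    have lip: "v z \<le> v y + L * norm (z - y)"
      if v: "v \<in> perron_class" and "cball y \<rho> \<subseteq> \<Omega>" "z \<in> cball y \<rho>" for v y z
      unfolding L_def
    proof (rule subsol_lipschitz[OF _ _ \<open>\<rho> > 0\<close> that(2) _ _ _ that(3)])
      show "subsol \<Omega> h v" "continuous_on \<Omega> v"
        using v closure_subset by (auto simp: perron_class_def intro: continuous_on_subset)
      show "\<bar>v x\<bar> \<le> N" if "x \<in> \<Omega>" for x
        unfolding N_def using that closure_subset by (intro perron_class_bounds[OF v]) blast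
      show "h x (v x) \<le> max K 0" if "x \<in> \<Omega>" for x
        using h_bound[OF that, of "v x"] by simp
    qed simp
    have est: "\<bar>perron_fun y - perron_fun x\<bar> \<le> L * norm (y - x)" if y: "y \<in> ball x \<rho>" for y
    proof -
      have sub: "cball x \<rho> \<subseteq> \<Omega>" "cball y \<rho> \<subseteq> \<Omega>"
      proof -
        show "cball x \<rho> \<subseteq> \<Omega>" using \<rho>0 \<open>\<rho>0 > 0\<close> by (force simp: \<rho>_def)
        show "cball y \<rho> \<subseteq> \<Omega>"
        proof
          fix z assume "z \<in> cball y \<rho>"
          then have "dist x z \<le> \<rho>0" using y dist_triangle[of x z y] by (simp add: \<rho>_def)
          then show "z \<in> \<Omega>" using \<rho>0 by auto
        qed
      qed
      have cl: "x \<in> closure \<Omega>" "y \<in> closure \<Omega>" using sub \<open>\<rho> > 0\<close> closure_subset by force+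
      have "perron_fun y \<le> perron_fun x + L * norm (y - x)"
      proof (rule perron_least)
        fix v assume v: "v \<in> perron_class"
        have "v y \<le> v x + L * norm (y - x)" using y by (intro lip[OF v sub(1)]) simp
        with perron_upper[OF cl(1) v] show "v y \<le> perron_fun x + L * norm (y - x)" by linarith
      qed
      moreover have "perron_fun x \<le> perron_fun y + L * norm (y - x)"
      proof (rule perron_least)
        fix v assume v: "v \<in> perron_class"
        have "v x \<le> v y + L * norm (x - y)"
          using y by (intro lip[OF v sub(2)]) (simp add: dist_commute)
        with perron_upper[OF cl(2) v] show "v x \<le> perron_fun y + L * norm (y - x)"
          by (simp add: norm_minus_commute)
      qed
      ultimately show ?thesis by linarith
    qed
    have "((\<lambda>y. L * norm (y - x)) \<longlongrightarrow> L * norm (x - x)) (at x within closure \<Omega>)"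
      by (intro tendsto_intros)
    then have lim: "((\<lambda>y. L * norm (y - x)) \<longlongrightarrow> 0) (at x within closure \<Omega>)" by simp
    have "\<forall>\<^sub>F y in nhds x. y \<in> ball x \<rho>"
      using \<open>\<rho> > 0\<close> by (intro eventually_nhds_in_open) auto
    then have "\<forall>\<^sub>F y in at x within closure \<Omega>. y \<in> ball x \<rho>"
      by (simp add: eventually_at_filter eventually_mono)
    then have "\<forall>\<^sub>F y in at x within closure \<Omega>. norm (perron_fun y - perron_fun x) \<le> L * norm (y - x)"
      by eventually_elim (use est in simp)
    from Lim_null_comparison[OF this lim] show ?thesis by (rule LIM_zero_cancel)
  next
    case False
    then have y: "x \<in> frontier \<Omega>" using closure_cases x by blast
    show ?thesis
    proof (rule tendstoI)
      fix e :: real assume "e > 0"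
      then obtain A where A: "\<And>z. z \<in> closure \<Omega> \<Longrightarrow> \<bar>perron_fun z - b x\<bar> \<le> e / 2 + cone_fn A c x z"
        using perron_near_boundary[OF half_gt_zero y] by blast
      have "isCont (cone_fn A c x) x" unfolding cone_fn_def[abs_def] by (intro continuous_intros)
      then have "(cone_fn A c x \<longlongrightarrow> 0) (at x within closure \<Omega>)"
        by (metis cone_self continuous_at continuous_at_imp_continuous_at_within continuous_within)
      from order_tendstoD(2)[OF this, of "e / 2"] \<open>e > 0\<close>
      have "\<forall>\<^sub>F z in at x within closure \<Omega>. cone_fn A c x z < e / 2" by simp
      moreover have "\<forall>\<^sub>F z in at x within closure \<Omega>. z \<in> closure \<Omega>"
        by (simp add: eventually_at_filter)
      ultimately show "\<forall>\<^sub>F z in at x within closure \<Omega>. dist (perron_fun z) (perron_fun x) < e"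
      proof eventually_elim
        case (elim z)
        with A[OF elim(2)] show ?case by (simp add: perron_boundary[OF y] dist_real_def)
      qed
    qed
  qed
qed

text \<open>The bump alters the supremum only inside \<open>\<Omega>\<close> and only upwards, so it
  respects the boundary data and the floor: it would be a competitor exceeding the supremum.\<close>

lemma perron_supersol: "subsol \<Omega> (\<lambda>x t. - h x (- t)) (\<lambda>x. - perron_fun x)"
proof (rule ccontr)
  assume "\<not> ?thesis"
  then obtain w x0 where w: "subsol \<Omega> h w" "continuous_on (closure \<Omega>) w" "\<And>x. perron_fun x \<le> w x"
    "\<And>x. x \<notin> \<Omega> \<Longrightarrow> w x = perron_fun x" and x0: "x0 \<in> \<Omega>" "perron_fun x0 < w x0"
    using subsol_bump[OF open_\<Omega> h_cont perron_subsol perron_continuous closure_subset] by blast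
  have "w x \<le> b x" if "x \<in> frontier \<Omega>" for x
    using w(4)[OF frontier_disjoint[OF that]] perron_boundary[OF that] by simp
  moreover have "- B - 2 * c * R\<^sup>2 \<le> w x" if "x \<in> closure \<Omega>" for x
    using perron_bounds[OF that] w(3)[of x] by linarith
  ultimately have "w \<in> perron_class" using w(1,2) by (simp add: perron_class_def)
  then have "w x0 \<le> perron_fun x0" using x0 closure_subset by (intro perron_upper) auto
  with x0 show False by simp
qed

end

subsection \<open>Truncation and change of unknown\<close>

text \<open>The circularity to break: the barriers must dominate \<open>h\<close> on the range of
  the solution, but that range grows with the barriers. Cubic strength against subcubic growth lets
  \<open>s\<close> be fixed in advance, and \<open>h\<close> is then altered only outside the
  resulting range.\<close>

lemma jet_dirichlet_solution:
  fixes \<Omega> :: "'a::euclidean_space set"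
  assumes "open \<Omega>" "bounded \<Omega>" "\<Omega> \<noteq> {}"
    and b: "continuous_on (frontier \<Omega>) b"
    and cont: "continuous_on (\<Omega> \<times> UNIV) (\<lambda>(x, t). h x t)"
    and bdd: "\<And>T. \<exists>C. \<forall>x\<in>\<Omega>. \<forall>t. \<bar>t\<bar> \<le> T \<longrightarrow> \<bar>h x t\<bar> \<le> C"
    and pos: "\<And>\<epsilon>. \<epsilon> > 0 \<Longrightarrow> \<exists>T. \<forall>x\<in>\<Omega>. \<forall>t\<ge>T. h x t \<le> \<epsilon> * t^3"
    and neg: "\<And>\<epsilon>. \<epsilon> > 0 \<Longrightarrow> \<exists>T. \<forall>x\<in>\<Omega>. \<forall>t\<le>T. \<epsilon> * t^3 \<le> h x t"
  obtains u where "continuous_on (closure \<Omega>) u" "\<And>x. x \<in> frontier \<Omega> \<Longrightarrow> u x = b x"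
    "subsol \<Omega> h u" "subsol \<Omega> (\<lambda>x t. - h x (- t)) (\<lambda>x. - u x)"
proof -
  define R where "R = diameter (closure \<Omega>) + 1"
  have bc: "bounded (closure \<Omega>)" using \<open>bounded \<Omega>\<close> by (rule bounded_closure)
  have "R > 0" using diameter_ge_0[OF bc] by (simp add: R_def)
  have diam: "norm (x - y) \<le> R" if "x \<in> closure \<Omega>" "y \<in> closure \<Omega>" for x y
    using diameter_bounded_bound[OF bc that] by (simp add: R_def dist_norm)
  have "compact (b ` frontier \<Omega>)"
    using b \<open>bounded \<Omega>\<close> by (intro compact_continuous_image compact_frontier_bounded)
  then obtain B where "B > 0" and B: "\<And>x. x \<in> frontier \<Omega> \<Longrightarrow> \<bar>b x\<bar> \<le> B"
    using compact_imp_bounded bounded_pos by (metis imageI real_norm_def)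
  \<comment> \<open>Below \<open>s = 2 c R^2\<close> and \<open>c^3 R^2 = s^3 / (8 R^4)\<close>, so this \<open>\<epsilon>\<close> makes \<open>\<epsilon> (2 s)^3\<close> half of it.\<close>
  define \<epsilon> where "\<epsilon> = 1 / (128 * R^4)"
  have "\<epsilon> > 0" using \<open>R > 0\<close> by (simp add: \<epsilon>_def)
  obtain T1 where T1: "\<And>x t. x \<in> \<Omega> \<Longrightarrow> T1 \<le> t \<Longrightarrow> h x t \<le> \<epsilon> * t^3"
    using pos[OF \<open>\<epsilon> > 0\<close>] by blast
  obtain T2 where T2: "\<And>x t. x \<in> \<Omega> \<Longrightarrow> t \<le> T2 \<Longrightarrow> \<epsilon> * t^3 \<le> h x t"
    using neg[OF \<open>\<epsilon> > 0\<close>] by blast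
  \<comment> \<open>Adding \<open>B\<close> ensures that \<open>t \<ge> - B\<close> with
    \<open>\<bar>t\<bar> > T\<close> is positive and past \<open>T1\<close>, and symmetrically for
    \<open>t \<le> B\<close>.\<close>
  define T where "T = max \<bar>T1\<bar> \<bar>T2\<bar> + B"
  obtain C0 where C0: "\<And>x t. x \<in> \<Omega> \<Longrightarrow> \<bar>t\<bar> \<le> T \<Longrightarrow> \<bar>h x t\<bar> \<le> C0"
    using bdd[of T] by blast
  define C where "C = max C0 0"
  \<comment> \<open>The last summand pays for the size of \<open>h\<close> on
    \<open>[-T, T]\<close>, the \<open>1\<close> gives \<open>s \<le> s^3\<close>, and the
    \<open>B\<close> gives \<open>B + s \<le> 2 * s\<close>.\<close>
  define s where "s = 1 + B + 8 * R^4 * (C + 1)"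
  have "C \<ge> 0" by (simp add: C_def)
  have "0 < R^4" using \<open>R > 0\<close> by simp
  then have "0 \<le> 8 * R^4 * (C + 1)" using \<open>C \<ge> 0\<close> by simp
  then have s: "1 \<le> s" "B \<le> s" "8 * R^4 * (C + 1) \<le> s" using \<open>B > 0\<close> by (auto simp: s_def)
  define c where "c = s / (2 * R^2)"
  have "c > 0" using s \<open>R > 0\<close> by (simp add: c_def)
  have cR: "2 * c * R^2 = s" using \<open>R > 0\<close> by (simp add: c_def)
  have cR3: "c^3 * R^2 = s^3 / (8 * R^4)"
    using \<open>R > 0\<close> by (simp add: c_def field_simps power2_eq_square power3_eq_cube power4_eq_xxxx)
  have "s \<le> s^3" using s(1) by (intro self_le_power) auto
  then have "8 * R^4 * (C + 1) \<le> s^3" using s by linarith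
  then have "C + 1 \<le> s^3 / (8 * R^4)" using \<open>0 < R^4\<close> by (simp add: field_simps)
  then have CK: "C < c^3 * R^2" by (simp add: cR3)
  have big: "\<epsilon> * t^3 < c^3 * R^2" if "0 \<le> t" "t \<le> B + s" for t
  proof -
    have "t^3 \<le> (2 * s)^3" using that s by (intro power_mono) auto
    then have "\<epsilon> * t^3 \<le> \<epsilon> * (2 * s)^3" using \<open>\<epsilon> > 0\<close> by simp
    also have "\<dots> = s^3 / (16 * R^4)" by (simp add: \<epsilon>_def power3_eq_cube)
    also have "\<dots> < s^3 / (8 * R^4)" using s \<open>0 < R^4\<close> by (intro divide_strict_left_mono) auto
    finally show ?thesis by (simp add: cR3)
  qed
  have small: "\<bar>h x t\<bar> < c^3 * R^2" if "x \<in> \<Omega>" "\<bar>t\<bar> \<le> T" for x t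
    using C0[OF that] CK by (simp add: C_def)
  have up: "h x t < c^3 * R^2" if "x \<in> \<Omega>" "- B \<le> t" "t \<le> B + s" for x t
  proof (cases "\<bar>t\<bar> \<le> T")
    case False
    then have "T1 \<le> t" "0 \<le> t" using that \<open>B > 0\<close> unfolding T_def by linarith+
    with T1[OF that(1), of t] big[of t] that show ?thesis by simp
  qed (use small[OF that(1)] in force)
  have low: "- (c^3 * R^2) < h x t" if "x \<in> \<Omega>" "t \<le> B" "- (B + s) \<le> t" for x t
  proof (cases "\<bar>t\<bar> \<le> T")
    case False
    then have "t \<le> T2" "t \<le> 0" using that \<open>B > 0\<close> unfolding T_def by linarith+
    with T2[OF that(1), of t] big[of "- t"] that show ?thesis by simp
  qed (use small[OF that(1)] in force)
  \<comment> \<open>Clamping yields the global bound \<open>K\<close>, preserves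
    \<open>- B \<le> t\<close> and \<open>t \<le> B\<close>, and brings all values into the range
    where the strict bounds hold.\<close>
  define clamp where "clamp t = max (- (B + s)) (min (B + s) t)" for t
  have clamp: "- (B + s) \<le> clamp t" "clamp t \<le> B + s" for t
    using s \<open>B > 0\<close> by (auto simp: clamp_def)
  obtain K where K: "\<And>x t. x \<in> \<Omega> \<Longrightarrow> \<bar>t\<bar> \<le> B + s \<Longrightarrow> \<bar>h x t\<bar> \<le> K"
    using bdd[of "B + s"] by blast
  interpret dirichlet_barriers \<Omega> b "\<lambda>x t. h x (clamp t)" c R B K
  proof
    have "continuous_on (\<Omega> \<times> UNIV) (\<lambda>z. (\<lambda>(x, t). h x t) (fst z, clamp (snd z)))"
      unfolding clamp_def
      by (rule continuous_on_compose2[OF cont]) (auto intro!: continuous_intros)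
    then show "continuous_on (\<Omega> \<times> UNIV) (\<lambda>(x, t). h x (clamp t))"
      by (simp add: case_prod_unfold)
    show "h x (clamp t) < c^3 * R^2" if "x \<in> \<Omega>" "- B \<le> t" for x t
      using that s \<open>B > 0\<close> by (intro up clamp) (auto simp: clamp_def max_def min_def)
    show "- (c^3 * R^2) < h x (clamp t)" if "x \<in> \<Omega>" "t \<le> B" for x t
      using that s \<open>B > 0\<close> by (intro low clamp) (auto simp: clamp_def max_def min_def)
    show "h x (clamp t) \<le> K" if "x \<in> \<Omega>" for x t
      using K[OF that, of "clamp t"] clamp[of t] by (simp add: abs_le_iff)
  qed (fact assms(1-4) \<open>c > 0\<close> \<open>R > 0\<close> diam B)+
  \<comment> \<open>The a priori bound of the supremum is \<open>B + 2 * c * R^2 = B + s\<close>, so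
    the clamp acts as the identity on its values and the original equation is recovered.\<close>
  have clamp_u: "clamp (perron_fun x) = perron_fun x" if "x \<in> \<Omega>" for x
  proof -
    have "x \<in> closure \<Omega>" using that closure_subset by blast
    from perron_bounds[OF this] show ?thesis unfolding cR by (auto simp: clamp_def abs_le_iff)
  qed
  show thesis
  proof (rule that[OF perron_continuous perron_boundary])
    show "subsol \<Omega> h perron_fun" using perron_subsol by (simp add: subsol_def clamp_u)
    show "subsol \<Omega> (\<lambda>x t. - h x (- t)) (\<lambda>x. - perron_fun x)"
      using perron_supersol by (simp add: subsol_def clamp_u)
  qed
qed

section \<open>Jets of C2 functions and derivatives of primitives\<close>

lemma has_C2_derivs_jets:
  fixes \<phi> :: "real^'n \<Rightarrow> real"
  assumes C2: "has_C2_derivs \<phi> D\<phi> D2\<phi> \<Omega>" and "open \<Omega>" "x \<in> \<Omega>"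
  shows "jet_above \<phi> x (D\<phi> x) (\<lambda>k. D2\<phi> x *v k)"
    and "jet_above (\<lambda>y. - \<phi> y) x (- D\<phi> x) (\<lambda>k. - (D2\<phi> x *v k))"
proof -
  have lin: "linear (\<lambda>k. D2\<phi> x *v k)" by (rule matrix_vector_mul_linear)
  have "\<forall>\<^sub>F y in nhds x. y \<in> \<Omega>" using assms(2,3) by (rule eventually_nhds_in_open)
  then have D: "\<forall>\<^sub>F y in nhds x. (\<phi> has_derivative (\<lambda>k. D\<phi> y \<bullet> k)) (at y)"
    by eventually_elim (use C2 in \<open>simp add: has_C2_derivs_def gderiv_def inner_commute\<close>)
  have D2: "(D\<phi> has_derivative (\<lambda>k. D2\<phi> x *v k)) (at x)"
    using C2 \<open>x \<in> \<Omega>\<close> by (simp add: has_C2_derivs_def)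
  note taylor = taylor2_peano[OF D D2]
  show "jet_above \<phi> x (D\<phi> x) (\<lambda>k. D2\<phi> x *v k)"
    unfolding jet_above_def
  proof (intro conjI allI impI lin)
    fix e :: real assume "e > 0"
    from taylor[OF this] show "\<forall>\<^sub>F k in nhds 0. \<phi> (x + k) \<le> \<phi> x + D\<phi> x \<bullet> k + (D2\<phi> x *v k) \<bullet> k / 2 + e * (k \<bullet> k)"
      by eventually_elim linarith
  qed
  show "jet_above (\<lambda>y. - \<phi> y) x (- D\<phi> x) (\<lambda>k. - (D2\<phi> x *v k))"
    unfolding jet_above_def
  proof (intro conjI allI impI linear_compose_neg lin)
    fix e :: real assume "e > 0"
    from taylor[OF this] show "\<forall>\<^sub>F k in nhds 0. - \<phi> (x + k) \<le> - \<phi> x + (- D\<phi> x) \<bullet> k +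
        (- (D2\<phi> x *v k)) \<bullet> k / 2 + e * (k \<bullet> k)"
    proof eventually_elim
      case (elim k)
      then show ?case by (simp add: inner_minus_left abs_le_iff)
    qed
  qed
qed

lemma primitive_has_derivative:
  assumes "continuous_on UNIV g"
  shows "(primitive g has_real_derivative g s) (at s)"
proof -
  \<comment> \<open>A symmetric interval with \<open>0\<close> and \<open>s\<close> in its interior
    treats both signs of \<open>s\<close> and yields an unrestricted derivative.\<close>
  define a where "a = \<bar>s\<bar> + 1"
  have "((\<lambda>u. LBINT y=ereal 0..ereal u. g y) has_vector_derivative g s) (at s within {-a..a})"
    by (rule interval_integral_FTC2) (auto simp: a_def intro: continuous_on_subset[OF assms])
  moreover have "at s within {-a..a} = at s"
    by (rule at_within_Icc_at) (auto simp: a_def)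
  ultimately show ?thesis
    by (simp add: has_real_derivative_iff_has_vector_derivative primitive_def[abs_def])
qed

lemma primitive_0 [simp]: "primitive g 0 = 0"
  by (simp add: primitive_def interval_integral_endpoints_same)

text \<open>The change of unknown \<open>v = \<Psi> u\<close> with \<open>\<Psi>' = exp \<circ> G\<close> absorbs the gradient term.\<close>

locale gradient_removal =
  fixes g :: "real \<Rightarrow> real" and s0 :: real
  assumes g_cont: "continuous_on UNIV g" and s0: "s0 \<ge> 0"
    and g_pos: "\<And>s. s0 \<le> s \<Longrightarrow> 0 \<le> g s" and g_neg: "\<And>s. s \<le> - s0 \<Longrightarrow> g s \<le> 0"
begin

abbreviation "G \<equiv> primitive g"

definition \<Psi> :: "real \<Rightarrow> real" where "\<Psi> = primitive (\<lambda>s. exp (G s))"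

definition \<Theta> :: "real \<Rightarrow> real" where "\<Theta> = inv \<Psi>"

lemma G_deriv: "(G has_real_derivative g s) (at s)"
  by (rule primitive_has_derivative[OF g_cont])

lemma G_cont: "continuous_on A G"
  by (intro continuous_at_imp_continuous_on ballI DERIV_isCont[OF G_deriv])

lemma \<Psi>_deriv: "(\<Psi> has_real_derivative exp (G s)) (at s)"
  unfolding \<Psi>_def by (intro primitive_has_derivative continuous_intros G_cont)

lemma \<Psi>_deriv2: "((\<lambda>s. exp (G s)) has_real_derivative exp (G s) * g s) (at s)"
  by (rule DERIV_fun_exp[OF G_deriv])

lemma \<Psi>_0: "\<Psi> 0 = 0" by (simp add: \<Psi>_def)

lemma \<Psi>_cont: "isCont \<Psi> s"
  by (rule DERIV_isCont[OF \<Psi>_deriv])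

lemma \<Psi>_strict_mono: "s < t \<Longrightarrow> \<Psi> s < \<Psi> t"
  using \<Psi>_deriv exp_gt_zero by (intro DERIV_pos_imp_increasing[of s t \<Psi>]) blast+

lemma \<Psi>_le_iff: "\<Psi> s \<le> \<Psi> t \<longleftrightarrow> s \<le> t"
  using \<Psi>_strict_mono[of s t] \<Psi>_strict_mono[of t s] by (cases s t rule: linorder_cases) auto

text \<open>The sign of \<open>g\<close> beyond \<open>s0\<close> makes \<open>G\<close>
  nondecreasing there, so the slope of \<open>\<Psi>\<close> never falls below
  \<open>exp (G s0)\<close>. This linear growth, with its mirror image on the left, makes
  \<open>\<Psi>\<close> onto.\<close>

lemma \<Psi>_ge:
  assumes "s0 \<le> s"
  shows "\<Psi> s0 + exp (G s0) * (s - s0) \<le> \<Psi> s"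
proof -
  have "G s0 \<le> G t" if "s0 \<le> t" for t
    by (rule DERIV_nonneg_imp_nondecreasing[OF that]) (use G_deriv g_pos in blast)
  then have d: "\<exists>y. ((\<lambda>t. \<Psi> t - exp (G s0) * t) has_real_derivative y) (at t) \<and> 0 \<le> y"
    if "s0 \<le> t" for t
    using that by (intro exI[of _ "exp (G t) - exp (G s0)"])
      (auto intro!: derivative_eq_intros \<Psi>_deriv)
  have "\<Psi> s0 - exp (G s0) * s0 \<le> \<Psi> s - exp (G s0) * s"
    by (rule DERIV_nonneg_imp_nondecreasing[OF assms]) (rule d)
  then show ?thesis by (simp add: algebra_simps)
qed

lemma \<Psi>_le:
  assumes "s \<le> - s0"
  shows "\<Psi> s \<le> \<Psi> (- s0) + exp (G (- s0)) * (s + s0)"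
proof -
  have "G (- s0) \<le> G t" if "t \<le> - s0" for t
    by (rule DERIV_nonpos_imp_nonincreasing[OF that]) (use G_deriv g_neg in blast)
  then have d: "\<exists>y. ((\<lambda>t. \<Psi> t - exp (G (- s0)) * t) has_real_derivative y) (at t) \<and> 0 \<le> y"
    if "t \<le> - s0" for t
    using that by (intro exI[of _ "exp (G t) - exp (G (- s0))"])
      (auto intro!: derivative_eq_intros \<Psi>_deriv)
  have "\<Psi> s - exp (G (- s0)) * s \<le> \<Psi> (- s0) - exp (G (- s0)) * (- s0)"
    by (rule DERIV_nonneg_imp_nondecreasing[OF assms]) (rule d)
  then show ?thesis by (simp add: algebra_simps)
qed

lemma \<Psi>_surj: "surj \<Psi>"
proof -
  have "\<exists>s. \<Psi> s = t" for t
  proof -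
    define s1 where "s1 = s0 + \<bar>t - \<Psi> s0\<bar> / exp (G s0)"
    define s2 where "s2 = - s0 - \<bar>t - \<Psi> (- s0)\<bar> / exp (G (- s0))"
    have "t \<le> \<Psi> s1" using \<Psi>_ge[of s1] by (simp add: s1_def)
    moreover have "\<Psi> s2 \<le> t" using \<Psi>_le[of s2] by (simp add: s2_def)
    moreover have "s2 \<le> s1" using s0 by (simp add: s1_def s2_def)
      (smt (verit) divide_nonneg_pos abs_ge_zero exp_gt_zero)
    ultimately show ?thesis using IVT[of \<Psi> s2 t s1] \<Psi>_cont by blast
  qed
  then show ?thesis by (metis surjI)
qed

lemma \<Psi>_\<Theta> [simp]: "\<Psi> (\<Theta> t) = t"
  unfolding \<Theta>_def by (rule surj_f_inv_f[OF \<Psi>_surj])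

lemma \<Theta>_\<Psi> [simp]: "\<Theta> (\<Psi> s) = s"
proof -
  have "inj \<Psi>" by (rule injI) (metis \<Psi>_le_iff order.eq_iff)
  then show ?thesis unfolding \<Theta>_def by (rule inv_f_f)
qed

lemma \<Theta>_le_iff: "\<Theta> s \<le> \<Theta> t \<longleftrightarrow> s \<le> t"
  using \<Psi>_le_iff[of "\<Theta> s" "\<Theta> t"] by simp

lemma \<Theta>_cont: "continuous_on A \<Theta>"
proof -
  have "isCont \<Theta> (\<Psi> s)" for s
    by (rule isCont_inverse_function[of 1]) (auto intro: \<Psi>_cont)
  then have "isCont \<Theta> t" for t using \<Psi>_\<Theta> by metis
  then show ?thesis by (simp add: continuous_at_imp_continuous_on)
qed

text \<open>A test function touching \<open>u\<close> gives a jet of \<open>u\<close>, and the chain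
  rule carries it to a jet of \<open>v\<close>, a composition of \<open>\<Psi>\<close> with
  \<open>u\<close>. The operator for \<open>v\<close> is then \<open>a x ^ 3\<close> times the
  operator for \<open>u\<close>, and this factor is positive.\<close>

lemma viscosity_of_jet_solution:
  fixes \<Omega> :: "(real^'n) set"
  assumes "open \<Omega>" and vcont: "continuous_on (closure \<Omega>) v"
    and sub: "subsol \<Omega> (\<lambda>x t. exp (3 * G (\<Theta> t)) * f x (\<Theta> t)) v"
    and super: "subsol \<Omega> (\<lambda>x t. - (exp (3 * G (\<Theta> (- t))) * f x (\<Theta> (- t)))) (\<lambda>x. - v x)"
  shows "viscosity_subsolution \<Omega> f g (\<lambda>x. \<Theta> (v x))"
    and "viscosity_supersolution \<Omega> f g (\<lambda>x. \<Theta> (v x))"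
proof -
  define u where "u x = \<Theta> (v x)" for x
  have vu: "v x = \<Psi> (u x)" for x by (simp add: u_def)
  have ucont: "isCont u x" if "x \<in> \<Omega>" for x
  proof -
    have "continuous_on \<Omega> u"
      unfolding u_def using closure_subset
      by (intro continuous_on_compose2[OF \<Theta>_cont[of UNIV]] continuous_on_subset[OF vcont]) auto
    then show ?thesis using that \<open>open \<Omega>\<close> by (simp add: continuous_on_eq_continuous_at)
  qed
  have der: "\<forall>\<^sub>F s in nhds r. (\<Psi> has_real_derivative exp (G s)) (at s)" for r
    by (simp add: \<Psi>_deriv)
  define a where "a x = exp (G (u x))" for x
  have a: "a x > 0" for x by (simp add: a_def)
  have a3: "exp (3 * G (u x)) = a x ^ 3" for x
    by (simp add: a_def exp_of_nat_mult[symmetric])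
  \<comment> \<open>This is the Hessian from the chain rule with
    \<open>\<Psi>'' = exp G * g\<close>. On the gradient \<open>a x *\<^sub>R p\<close> its rank-one
    part contributes \<open>a x ^ 3 * g (u x) * norm p ^ 4\<close>, the gradient term.\<close>
  define Z where "Z x p X k = a x *\<^sub>R (X *v k) + ((a x * g (u x)) * (p \<bullet> k)) *\<^sub>R p"
    for x p k :: "real^'n" and X :: "real^'n^'n"
  have Z: "Z x p X (a x *\<^sub>R p) \<bullet> (a x *\<^sub>R p) + a x ^ 3 * f x (u x) = a x ^ 3 * inf_lap_op f g x (u x) p X"
    for x p X
  proof -
    have "norm p ^ 4 = (p \<bullet> p) * (p \<bullet> p)"
      by (simp add: dot_square_norm power2_eq_square power4_eq_xxxx)
    then show ?thesis
      by (simp add: Z_def inf_lap_op_def inner_add_left matrix_vector_mult_scaleR power3_eq_cube algebra_simps)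
  qed
  have linZ: "linear (Z x p X)" for x p X
    unfolding Z_def[abs_def]
    by (intro linearI) (auto simp: matrix_vector_mult_scaleR algebra_simps)
  show "viscosity_subsolution \<Omega> f g (\<lambda>x. \<Theta> (v x))"
    unfolding viscosity_subsolution_def u_def[symmetric]
  proof (intro allI impI)
    fix \<phi> D\<phi> D2\<phi> x assume C2: "has_C2_derivs \<phi> D\<phi> D2\<phi> \<Omega>" and x: "x \<in> \<Omega>"
      and touch: "\<forall>\<^sub>F y in nhds x. u y - \<phi> y \<le> u x - \<phi> x"
    have "jet_above u x (D\<phi> x) (\<lambda>k. D2\<phi> x *v k)"
    proof (rule jet_above_touch[OF has_C2_derivs_jets(1)[OF C2 \<open>open \<Omega>\<close> x]])
      show "\<forall>\<^sub>F k in nhds 0. u (x + k) - u x \<le> \<phi> (x + k) - \<phi> x"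
        using touch unfolding eventually_nhds_0_shift[of _ x] by eventually_elim simp
    qed
    from jet_above_compose[OF this ucont[OF x] der \<Psi>_deriv2]
    have "jet_above v x (a x *\<^sub>R D\<phi> x) (Z x (D\<phi> x) (D2\<phi> x))"
      by (simp add: a_def vu[abs_def] Z_def[abs_def])
    from subsolD[OF sub x this] have "0 \<le> a x ^ 3 * inf_lap_op f g x (u x) (D\<phi> x) (D2\<phi> x)"
      using Z[of x "D\<phi> x" "D2\<phi> x"] by (simp add: u_def[symmetric] a3)
    then show "0 \<le> inf_lap_op f g x (u x) (D\<phi> x) (D2\<phi> x)"
      using zero_less_power[OF a[of x], of 3] by (simp add: zero_le_mult_iff)
  qed
  show "viscosity_supersolution \<Omega> f g (\<lambda>x. \<Theta> (v x))"
    unfolding viscosity_supersolution_def u_def[symmetric]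
  proof (intro allI impI)
    fix \<phi> D\<phi> D2\<phi> x assume C2: "has_C2_derivs \<phi> D\<phi> D2\<phi> \<Omega>" and x: "x \<in> \<Omega>"
      and touch: "\<forall>\<^sub>F y in nhds x. u x - \<phi> x \<le> u y - \<phi> y"
    have "jet_above (\<lambda>y. - u y) x (- D\<phi> x) (\<lambda>k. - (D2\<phi> x *v k))"
    proof (rule jet_above_touch[OF has_C2_derivs_jets(2)[OF C2 \<open>open \<Omega>\<close> x]])
      show "\<forall>\<^sub>F k in nhds 0. - u (x + k) - - u x \<le> - \<phi> (x + k) - - \<phi> x"
        using touch unfolding eventually_nhds_0_shift[of _ x] by eventually_elim simp
    qed
    from jet_below_compose[OF this ucont[OF x] der \<Psi>_deriv2]
    have "jet_above (\<lambda>y. - v y) x (- (a x *\<^sub>R D\<phi> x)) (\<lambda>k. - Z x (D\<phi> x) (D2\<phi> x) k)"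
      by (simp add: a_def vu[abs_def] Z_def[abs_def])
    from subsolD[OF super x this] have "a x ^ 3 * inf_lap_op f g x (u x) (D\<phi> x) (D2\<phi> x) \<le> 0"
      using Z[of x "D\<phi> x" "D2\<phi> x"] linear_neg[OF linZ, of x "D\<phi> x" "D2\<phi> x" "a x *\<^sub>R D\<phi> x"]
      by (simp add: u_def[symmetric] a3)
    then show "inf_lap_op f g x (u x) (D\<phi> x) (D2\<phi> x) \<le> 0"
      using zero_less_power[OF a[of x], of 3] by (simp add: mult_le_0_iff)
  qed
qed

section \<open>Size of the transformed right-hand side\<close>

lemma transformed_bounded:
  assumes f_bdd: "\<And>c d :: real. bdd_above ((\<lambda>(x, t). \<bar>f x t\<bar>) ` (\<Omega> \<times> {c..d}))"
  shows "\<exists>C. \<forall>x\<in>\<Omega>. \<forall>t. \<bar>t\<bar> \<le> T \<longrightarrow> \<bar>exp (3 * G (\<Theta> t)) * f x (\<Theta> t)\<bar> \<le> C"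
proof -
  obtain C1 where "\<forall>x\<in>\<Omega>. \<forall>s\<in>{\<Theta> (- T)..\<Theta> T}. \<bar>f x s\<bar> \<le> C1"
    using f_bdd[of "\<Theta> (- T)" "\<Theta> T"] unfolding bdd_above_def by auto
  then have C1: "\<bar>f x s\<bar> \<le> C1" if "x \<in> \<Omega>" "s \<in> {\<Theta> (- T)..\<Theta> T}" for x s
    using that by blast
  have "compact ((\<lambda>s. exp (3 * G s)) ` {\<Theta> (- T)..\<Theta> T})"
    by (intro compact_continuous_image continuous_intros G_cont compact_Icc)
  then have "bdd_above ((\<lambda>s. exp (3 * G s)) ` {\<Theta> (- T)..\<Theta> T})"
    by (intro bounded_imp_bdd_above compact_imp_bounded)
  then obtain C2 where C2: "\<And>s. s \<in> {\<Theta> (- T)..\<Theta> T} \<Longrightarrow> exp (3 * G s) \<le> C2"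
    unfolding bdd_above_def by blast
  show ?thesis
  proof (intro exI[of _ "C2 * C1"] ballI allI impI)
    fix x t assume "x \<in> \<Omega>" "\<bar>t\<bar> \<le> T"
    then have "\<Theta> t \<in> {\<Theta> (- T)..\<Theta> T}" by (auto simp: \<Theta>_le_iff)
    from C1[OF \<open>x \<in> \<Omega>\<close> this] C2[OF this]
    show "\<bar>exp (3 * G (\<Theta> t)) * f x (\<Theta> t)\<bar> \<le> C2 * C1"
      unfolding abs_mult by (intro mult_mono) (auto intro: order_trans[OF less_imp_le[OF exp_gt_zero]])
  qed
qed

lemma transformed_growth_top:
  assumes "Limsup at_top (\<lambda>t. (SUP x\<in>\<Omega>. ereal (exp (3 * G t) * f x t)) / ereal (\<Psi> t ^ 3)) \<le> 0"
    and "\<epsilon> > 0"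
  shows "\<exists>T. \<forall>x\<in>\<Omega>. \<forall>t\<ge>T. exp (3 * G (\<Theta> t)) * f x (\<Theta> t) \<le> \<epsilon> * t ^ 3"
proof -
  have "\<forall>\<^sub>F t in at_top. (SUP x\<in>\<Omega>. ereal (exp (3 * G t) * f x t)) / ereal (\<Psi> t ^ 3) < ereal \<epsilon>"
    by (rule Limsup_lessD, rule order.strict_trans1[OF assms(1)]) (use assms(2) in simp)
  then obtain t0 where t0: "\<And>t. t0 \<le> t \<Longrightarrow>
      (SUP x\<in>\<Omega>. ereal (exp (3 * G t) * f x t)) / ereal (\<Psi> t ^ 3) < ereal \<epsilon>"
    unfolding eventually_at_top_linorder by blast
  \<comment> \<open>The cut-off \<open>1\<close> makes \<open>\<Psi> t\<close> positive, so the
    quotient can be multiplied out.\<close>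
  define t1 where "t1 = max t0 1"
  show ?thesis
  proof (intro exI[of _ "\<Psi> t1"] ballI allI impI)
    fix x r assume x: "x \<in> \<Omega>" and "\<Psi> t1 \<le> r"
    define t where "t = \<Theta> r"
    have t: "t1 \<le> t" using \<open>\<Psi> t1 \<le> r\<close> \<Psi>_le_iff[of t1 t] by (simp add: t_def)
    then have "0 < \<Psi> t" using \<Psi>_strict_mono[of 0 t] by (simp add: \<Psi>_0 t1_def)
    then have p: "0 < \<Psi> t ^ 3" by simp
    have "ereal (exp (3 * G t) * f x t) / ereal (\<Psi> t ^ 3)
        \<le> (SUP x\<in>\<Omega>. ereal (exp (3 * G t) * f x t)) / ereal (\<Psi> t ^ 3)"
      using p by (intro ereal_divide_right_mono SUP_upper x) simp
    also have "\<dots> < ereal \<epsilon>" using t by (intro t0) (simp add: t1_def)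
    finally have "exp (3 * G t) * f x t / \<Psi> t ^ 3 < \<epsilon>" using p by simp
    then show "exp (3 * G (\<Theta> r)) * f x (\<Theta> r) \<le> \<epsilon> * r ^ 3"
      using p by (simp add: t_def pos_divide_less_eq)
  qed
qed

text \<open>The denominator is negative here, so an upper bound on the quotient is a lower bound on
  the infimum. An infimum of minus infinity is excluded, as it would make the quotient plus
  infinity.\<close>

lemma transformed_growth_bot:
  assumes "Limsup at_bot (\<lambda>t. (INF x\<in>\<Omega>. ereal (exp (3 * G t) * f x t)) / ereal (\<Psi> t ^ 3)) \<le> 0"
    and "\<epsilon> > 0"
  shows "\<exists>T. \<forall>x\<in>\<Omega>. \<forall>t\<le>T. \<epsilon> * t ^ 3 \<le> exp (3 * G (\<Theta> t)) * f x (\<Theta> t)"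
proof -
  have "\<forall>\<^sub>F t in at_bot. (INF x\<in>\<Omega>. ereal (exp (3 * G t) * f x t)) / ereal (\<Psi> t ^ 3) < ereal \<epsilon>"
    by (rule Limsup_lessD, rule order.strict_trans1[OF assms(1)]) (use assms(2) in simp)
  then obtain t0 where t0: "\<And>t. t \<le> t0 \<Longrightarrow>
      (INF x\<in>\<Omega>. ereal (exp (3 * G t) * f x t)) / ereal (\<Psi> t ^ 3) < ereal \<epsilon>"
    unfolding eventually_at_bot_linorder by blast
  define t1 where "t1 = min t0 (- 1)"
  show ?thesis
  proof (intro exI[of _ "\<Psi> t1"] ballI allI impI)
    fix x r assume x: "x \<in> \<Omega>" and "r \<le> \<Psi> t1"
    define t where "t = \<Theta> r"
    have t: "t \<le> t1" using \<open>r \<le> \<Psi> t1\<close> \<Psi>_le_iff[of t t1] by (simp add: t_def)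
    then have "\<Psi> t < 0" using \<Psi>_strict_mono[of t 0] by (simp add: \<Psi>_0 t1_def)
    then have p: "\<Psi> t ^ 3 < 0" by (simp add: power_less_zero_eq)
    define I where "I = (INF x\<in>\<Omega>. ereal (exp (3 * G t) * f x t))"
    have I: "I \<le> ereal (exp (3 * G t) * f x t)" unfolding I_def by (rule INF_lower[OF x])
    have lt: "I / ereal (\<Psi> t ^ 3) < ereal \<epsilon>"
      unfolding I_def using t by (intro t0) (simp add: t1_def)
    have "\<epsilon> * \<Psi> t ^ 3 \<le> exp (3 * G t) * f x t"
    proof (cases I)
      case (real i)
      then have "i / \<Psi> t ^ 3 < \<epsilon>" using lt p by simp
      then have "\<epsilon> * \<Psi> t ^ 3 \<le> i" using p by (simp add: neg_divide_less_eq)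
      then show ?thesis using I real by simp
    next
      case PInf
      then show ?thesis using I by simp
    next
      case MInf
      then have "I / ereal (\<Psi> t ^ 3) = \<infinity>"
        using p by (simp add: divide_ereal_def)
      then show ?thesis using lt by simp
    qed
    then show "\<epsilon> * r ^ 3 \<le> exp (3 * G (\<Theta> r)) * f x (\<Theta> r)"
      by (simp add: t_def)
  qed
qed

end

theorem theorem4:
  fixes \<Omega> :: "(real^'n) set"
    and b :: "real^'n \<Rightarrow> real"
    and f :: "real^'n \<Rightarrow> real \<Rightarrow> real"
    and g G :: "real \<Rightarrow> real"
    and s0 :: real
    and \<nu> \<xi> :: ereal
  assumes "CARD('n) \<ge> 2"
    and "open \<Omega>" and "connected \<Omega>" and "\<Omega> \<noteq> {}" and "bounded \<Omega>"
    and "continuous_on (frontier \<Omega>) b"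
    and "continuous_on (\<Omega> \<times> UNIV) (\<lambda>(x, t). f x t)"
    and "continuous_on UNIV g"
    and "s0 \<ge> 0" and "\<And>s. s \<ge> s0 \<Longrightarrow> g s \<ge> 0" and "\<And>s. s \<le> - s0 \<Longrightarrow> g s \<le> 0"
    and "G = primitive g"
    and "\<And>c d :: real. bdd_above ((\<lambda>(x, t). \<bar>f x t\<bar>) ` (\<Omega> \<times> {c..d}))"
    and "\<nu> \<le> 0" and "\<xi> \<le> 0"
    and "Limsup at_top (\<lambda>t. (SUP x\<in>\<Omega>. ereal (exp (3 * G t) * f x t)) /
           ereal (primitive (\<lambda>s. exp (G s)) t ^ 3)) = \<nu>"
    and "Limsup at_bot (\<lambda>t. (INF x\<in>\<Omega>. ereal (exp (3 * G t) * f x t)) /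
           ereal (primitive (\<lambda>s. exp (G s)) t ^ 3)) = \<xi>"
  shows "\<exists>u. viscosity_solution_Dirichlet \<Omega> f g b u"
proof -
  interpret T: gradient_removal g s0
  proof
    show "continuous_on UNIV g" "s0 \<ge> 0" by (rule assms)+
    show "0 \<le> g s" if "s0 \<le> s" for s using that by (rule assms(10))
    show "g s \<le> 0" if "s \<le> - s0" for s using that by (rule assms(11))
  qed
  define h where "h x t = exp (3 * T.G (T.\<Theta> t)) * f x (T.\<Theta> t)" for x t
  have top: "Limsup at_top (\<lambda>t. (SUP x\<in>\<Omega>. ereal (exp (3 * T.G t) * f x t)) / ereal (T.\<Psi> t ^ 3)) \<le> 0"
    and bot: "Limsup at_bot (\<lambda>t. (INF x\<in>\<Omega>. ereal (exp (3 * T.G t) * f x t)) / ereal (T.\<Psi> t ^ 3)) \<le> 0"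
    using assms(14,15) unfolding assms(16,17)[symmetric] assms(12) T.\<Psi>_def .
  have "continuous_on UNIV T.\<Psi>"
    by (simp add: continuous_at_imp_continuous_on T.\<Psi>_cont)
  from continuous_on_compose2[OF this assms(6)]
  have b: "continuous_on (frontier \<Omega>) (\<lambda>x. T.\<Psi> (b x))" by simp
  have "continuous_on UNIV (\<lambda>t. T.G (T.\<Theta> t))"
    by (rule continuous_on_compose2[OF T.G_cont T.\<Theta>_cont subset_UNIV])
  then have "continuous_on UNIV (\<lambda>t. exp (3 * T.G (T.\<Theta> t)))"
    by (intro continuous_intros)
  then have *: "continuous_on (\<Omega> \<times> UNIV) (\<lambda>z. exp (3 * T.G (T.\<Theta> (snd z))))"
    by (rule continuous_on_compose2) (auto intro: continuous_intros)
  have "continuous_on (\<Omega> \<times> UNIV) (\<lambda>z. T.\<Theta> (snd z))"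
    by (rule continuous_on_compose2[OF T.\<Theta>_cont[of UNIV]]) (auto intro: continuous_intros)
  then have "continuous_on (\<Omega> \<times> UNIV) (\<lambda>z. (fst z, T.\<Theta> (snd z)))"
    by (intro continuous_on_Pair continuous_on_fst continuous_on_id)
  then have "continuous_on (\<Omega> \<times> UNIV) (\<lambda>z. (\<lambda>(x, t). f x t) (fst z, T.\<Theta> (snd z)))"
    by (rule continuous_on_compose2[OF assms(7)]) auto
  with * have "continuous_on (\<Omega> \<times> UNIV) (\<lambda>z. exp (3 * T.G (T.\<Theta> (snd z))) *
      (\<lambda>(x, t). f x t) (fst z, T.\<Theta> (snd z)))"
    by (rule continuous_on_mult)
  then have h: "continuous_on (\<Omega> \<times> UNIV) (\<lambda>(x, t). h x t)"
    by (simp add: h_def case_prod_unfold)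
  obtain v where v: "continuous_on (closure \<Omega>) v" "\<And>x. x \<in> frontier \<Omega> \<Longrightarrow> v x = T.\<Psi> (b x)"
    "subsol \<Omega> h v" "subsol \<Omega> (\<lambda>x t. - h x (- t)) (\<lambda>x. - v x)"
    using jet_dirichlet_solution[OF assms(2,5,4) b h
        T.transformed_bounded[OF assms(13), folded h_def] T.transformed_growth_top[OF top, folded h_def]
        T.transformed_growth_bot[OF bot, folded h_def]]
    by blast
  have "viscosity_solution_Dirichlet \<Omega> f g b (\<lambda>x. T.\<Theta> (v x))"
    unfolding viscosity_solution_Dirichlet_def
  proof (intro conjI ballI)
    show "continuous_on (closure \<Omega>) (\<lambda>x. T.\<Theta> (v x))"
      using v(1) by (rule continuous_on_compose2[OF T.\<Theta>_cont[of UNIV]]) auto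
    show "T.\<Theta> (v x) = b x" if "x \<in> frontier \<Omega>" for x using v(2)[OF that] by simp
    show "viscosity_subsolution \<Omega> f g (\<lambda>x. T.\<Theta> (v x))"
      "viscosity_supersolution \<Omega> f g (\<lambda>x. T.\<Theta> (v x))"
      using T.viscosity_of_jet_solution[OF assms(2) v(1)] v(3,4) by (simp_all add: h_def[abs_def])
  qed
  then show ?thesis by blast
qed

end
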